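(* Let $k\ge1$ and let $G,H$ be simple graphs with $|V(G)|=|V(H)|$. Then $G$ and $H$ are algebraically $k$-equivalent if and only if there is a level-$k$ quantum isomorphism map from $G$ to $H$.
   Context: Homomorphism tensors: for a $(k,k)$-bilabelled graph $\boldsymbol F=(F,\boldsymbol u,\boldsymbol v)$, $\boldsymbol F_G\in\mathbb C^{V(G)^k\times V(G)^k}$ has $(\boldsymbol x,\boldsymbol y)$-entry the number of homomorphisms $h:F\to G$ with $h(u_i)=x_i,h(v_i)=y_i$. Bilabelled minors: via edge contraction, edge deletion, deletion of unlabelled vertices. $\boldsymbol C_k$: vertices $[2k]$, in-labels $(1,\dots,k)$, out-labels $(k+1,\dots,2k)$, edges $\{i,i+1\}$ ($i\in[2k]\setminus\{k,2k\}$), $\{1,k+1\},\{k,2k\}$; $\boldsymbol M_k$: same vertices/labels, edges $\{i,i+k\}$. $\mathcal Q_k^P,\mathcal Q_k^S$ = bilabelled minors of $\boldsymbol C_k,\boldsymbol M_k$; $\mathcal Q_k$ their union. For $\sigma\in\mathfrak S_{2k}$, $(X^\sigma)_{\boldsymbol z}=X_{\boldsymbol w}$ with $w_{\sigma(i)}=z_i$ (index pairs viewed as $2k$-tuples). $\mathscr C_k$ = cyclic group of rotations of the cyclic sequence $(1,\dots,k,2k,\dots,k+1)$. $I$ identity, $J$ all-ones, $\odot$ entrywise product. Level-$k$ quantum isomorphism map from $G$ to $H$: linear $\Phi:\mathbb{C}^{V(G)^k\times V(G)^k}\to\mathbb{C}^{V(H)^k\times V(H)^k}$, completely positive, with $\Phi(\boldsymbol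 F_G\odot X)=\boldsymbol F_H\odot\Phi(X)$ for $\boldsymbol F\in\mathcal Q_k^P$, $\Phi(I)=I=\Phi^*(I)$, $\Phi(J)=J=\Phi^*(J)$ ($\Phi^*$ trace-inner-product adjoint), $\Phi(\boldsymbol F_G)=\boldsymbol F_H$ for $\boldsymbol F\in\mathcal Q_k$, $\Phi(X^\sigma)=\Phi(X)^\sigma$ for $\sigma\in\mathscr C_k$. Algebraic $k$-equivalence: $\widehat{\mathcal Q}^k_G$ is the smallest subalgebra of $\mathbb C^{V(G)^k\times V(G)^k}$ containing $I,J$, closed under conjugate transpose, under $X\mapsto\boldsymbol F_G\odot X$ for $\boldsymbol F\in\mathcal Q_k^P$, under $X\mapsto X^\sigma$ for $\sigma\in\mathscr C_k$, and containing $\boldsymbol F_G$ for all $\boldsymbol F\in\mathcal Q_k$. $G,H$ are algebraically $k$-equivalent if there is a vector space isomorphism $\varphi:\widehat{\mathcal Q}^k_G\to\widehat{\mathcal Q}^k_H$ with, for all $M,N$: $\varphi(M^* )=\varphi(M)^*$, $\varphi(MN)=\varphi(M)\varphi(N)$, $\varphi(\boldsymbol F_G\odot M)=\boldsymbol F_H\odot\varphi(M)$ ($\boldsymbol F\in\mathcal Q_k^P$), $\varphi(I)=I$, $\varphi(J)=J$, $\varphi(\boldsymbol F_G)=\boldsymbol F_H$ ($\boldsymbol F\in\mathcal Q_k$), $\varphi(M^\sigma)=\varphi(M)^\sigma$ ($\sigma\in\mathscr C_k$), and $\mathrm{tr}\,\varphi(M)=\mathrm{tr}\,M$. *)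

theory Defs
  imports "HOL-Analysis.Analysis"
begin

definition simple_graph :: "('a \<Rightarrow> 'a \<Rightarrow> bool) \<Rightarrow> bool" where
  "simple_graph adj \<longleftrightarrow> (\<forall>x y. adj x y \<longrightarrow> adj y x) \<and> (\<forall>x. \<not> adj x x)"

text \<open>A matrix in C^(V^k x V^k) is a function on lists; only lists of length k are indices,
  all other entries are required to be 0 (see tspace).\<close>
type_synonym 'a tmat = "'a list \<Rightarrow> 'a list \<Rightarrow> complex"

definition tuples :: "nat \<Rightarrow> 'a list set" where
  "tuples k = {xs. length xs = k}"

definition tspace :: "nat \<Rightarrow> 'a tmat set" where
  "tspace k = {M. \<forall>x y. \<not> (length x = k \<and> length y = k) \<longrightarrow> M x y = 0}"

definition mzero :: "'a tmat" where
  "mzero = (\<lambda>x y. 0)"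

definition madd :: "'a tmat \<Rightarrow> 'a tmat \<Rightarrow> 'a tmat" where
  "madd A B = (\<lambda>x y. A x y + B x y)"

definition msmult :: "complex \<Rightarrow> 'a tmat \<Rightarrow> 'a tmat" where
  "msmult c A = (\<lambda>x y. c * A x y)"

definition mmult :: "nat \<Rightarrow> 'a tmat \<Rightarrow> 'a tmat \<Rightarrow> 'a tmat" where
  "mmult k A B = (\<lambda>x y. \<Sum>z\<in>tuples k. A x z * B z y)"

definition mctrans :: "'a tmat \<Rightarrow> 'a tmat" where
  "mctrans A = (\<lambda>x y. cnj (A y x))"

definition mhad :: "'a tmat \<Rightarrow> 'a tmat \<Rightarrow> 'a tmat" where
  "mhad A B = (\<lambda>x y. A x y * B x y)"

definition mI :: "nat \<Rightarrow> 'a tmat" where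
  "mI k = (\<lambda>x y. if length x = k \<and> x = y then 1 else 0)"

definition mJ :: "nat \<Rightarrow> 'a tmat" where
  "mJ k = (\<lambda>x y. if length x = k \<and> length y = k then 1 else 0)"

definition mtrace :: "nat \<Rightarrow> 'a tmat \<Rightarrow> complex" where
  "mtrace k A = (\<Sum>x\<in>tuples k. A x x)"

definition tinner :: "nat \<Rightarrow> 'a tmat \<Rightarrow> 'a tmat \<Rightarrow> complex" where
  "tinner k A B = mtrace k (mmult k (mctrans A) B)"

definition munit :: "'a list \<Rightarrow> 'a list \<Rightarrow> 'a tmat" where
  "munit x y = (\<lambda>a b. if a = x \<and> b = y then 1 else 0)"

text \<open>A bilabelled graph: vertex set, edge set (edges are 2-element vertex sets),
  in-labels u and out-labels v.\<close>
record blg =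
  bV :: "nat set"
  bE :: "nat set set"
  bin :: "nat list"
  bout :: "nat list"

definition hom_tensor :: "('a \<Rightarrow> 'a \<Rightarrow> bool) \<Rightarrow> blg \<Rightarrow> 'a tmat" where
  "hom_tensor adj F = (\<lambda>x y. of_nat (card
     {h \<in> extensional (bV F).
        (\<forall>e\<in>bE F. \<forall>a\<in>e. \<forall>b\<in>e. a \<noteq> b \<longrightarrow> adj (h a) (h b))
        \<and> map h (bin F) = x \<and> map h (bout F) = y}))"

inductive_set bminors :: "blg \<Rightarrow> blg set" for F0 :: blg where
  base: "F0 \<in> bminors F0"
| del_edge: "F \<in> bminors F0 \<Longrightarrow> e \<in> bE F \<Longrightarrow>
     \<lparr>bV = bV F, bE = bE F - {e}, bin = bin F, bout = bout F\<rparr> \<in> bminors F0"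
| del_vertex: "F \<in> bminors F0 \<Longrightarrow> w \<in> bV F \<Longrightarrow> w \<notin> set (bin F) \<Longrightarrow> w \<notin> set (bout F) \<Longrightarrow>
     \<lparr>bV = bV F - {w}, bE = {e \<in> bE F. w \<notin> e}, bin = bin F, bout = bout F\<rparr> \<in> bminors F0"
| contract: "F \<in> bminors F0 \<Longrightarrow> {a, b} \<in> bE F \<Longrightarrow> a \<noteq> b \<Longrightarrow>
     \<lparr>bV = bV F - {b},
      bE = (\<lambda>e. (\<lambda>w. if w = b then a else w) ` e) ` (bE F - {{a, b}}),
      bin = map (\<lambda>w. if w = b then a else w) (bin F),
      bout = map (\<lambda>w. if w = b then a else w) (bout F)\<rparr> \<in> bminors F0"

definition Cgraph :: "nat \<Rightarrow> blg" where
  "Cgraph k = \<lparr>bV = {1..2*k},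
     bE = {{i, i+1} | i. i \<in> {1..2*k} - {k, 2*k}} \<union> {{1, k+1}, {k, 2*k}},
     bin = [1..<k+1], bout = [k+1..<2*k+1]\<rparr>"

definition Mgraph :: "nat \<Rightarrow> blg" where
  "Mgraph k = \<lparr>bV = {1..2*k},
     bE = {{i, i+k} | i. i \<in> {1..k}},
     bin = [1..<k+1], bout = [k+1..<2*k+1]\<rparr>"

definition QP :: "nat \<Rightarrow> blg set" where
  "QP k = bminors (Cgraph k)"

definition QS :: "nat \<Rightarrow> blg set" where
  "QS k = bminors (Mgraph k)"

definition Qk :: "nat \<Rightarrow> blg set" where
  "Qk k = QP k \<union> QS k"

text \<open>Positions of the 2k-tuple z = x @ y are indexed 0..2k-1 (paper position i is our i-1).
  (X^sigma)_z = X_w with w_{sigma(i)} = z_i, i.e. w_j = z_{sigma^{-1}(j)}.\<close>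
definition pact :: "nat \<Rightarrow> (nat \<Rightarrow> nat) \<Rightarrow> 'a tmat \<Rightarrow> 'a tmat" where
  "pact k \<sigma> X = (\<lambda>x y. if length x = k \<and> length y = k then
       (let z = x @ y;
            w = map (\<lambda>j. z ! inv_into {0..<2*k} \<sigma> j) [0..<2*k]
        in X (take k w) (drop k w))
     else 0)"

text \<open>The cyclic sequence (1,...,k,2k,...,k+1), 0-indexed: (0,...,k-1,2k-1,...,k).\<close>
definition cyc_seq :: "nat \<Rightarrow> nat list" where
  "cyc_seq k = [0..<k] @ rev [k..<2*k]"

definition rot :: "nat \<Rightarrow> nat \<Rightarrow> nat" where
  "rot k p = (if p < 2*k then
       cyc_seq k ! (((THE i. i < 2*k \<and> cyc_seq k ! i = p) + 1) mod (2*k))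
     else p)"

definition cyc_group :: "nat \<Rightarrow> (nat \<Rightarrow> nat) set" where
  "cyc_group k = {(rot k) ^^ j | j. True}"

definition lin_on :: "nat \<Rightarrow> ('a tmat \<Rightarrow> 'b tmat) \<Rightarrow> bool" where
  "lin_on k \<Phi> \<longleftrightarrow> (\<forall>X\<in>tspace k. \<forall>Y\<in>tspace k. \<forall>c.
      \<Phi> (madd X Y) = madd (\<Phi> X) (\<Phi> Y) \<and> \<Phi> (msmult c X) = msmult c (\<Phi> X))"

definition block_psd :: "nat \<Rightarrow> nat \<Rightarrow> (nat \<Rightarrow> nat \<Rightarrow> 'a tmat) \<Rightarrow> bool" where
  "block_psd k n B \<longleftrightarrow> (\<forall>v :: nat \<Rightarrow> 'a list \<Rightarrow> complex.
     (let q = (\<Sum>i<n. \<Sum>j<n. \<Sum>x\<in>tuples k. \<Sum>y\<in>tuples k. cnj (v i x) * B i j x y * v j y)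
      in Im q = 0 \<and> Re q \<ge> 0))"

definition completely_positive :: "nat \<Rightarrow> ('a tmat \<Rightarrow> 'b tmat) \<Rightarrow> bool" where
  "completely_positive k \<Phi> \<longleftrightarrow> (\<forall>n (B :: nat \<Rightarrow> nat \<Rightarrow> 'a tmat).
     (\<forall>i j. B i j \<in> tspace k) \<longrightarrow> block_psd k n B \<longrightarrow> block_psd k n (\<lambda>i j. \<Phi> (B i j)))"

definition adjoint :: "nat \<Rightarrow> ('a tmat \<Rightarrow> 'b tmat) \<Rightarrow> 'b tmat \<Rightarrow> 'a tmat" where
  "adjoint k \<Phi> Y = (\<lambda>x y. if length x = k \<and> length y = k
      then tinner k (\<Phi> (munit x y)) Y else 0)"

definition level_qi_map ::
  "nat \<Rightarrow> ('a \<Rightarrow> 'a \<Rightarrow> bool) \<Rightarrow> ('b \<Rightarrow> 'b \<Rightarrow> bool) \<Rightarrow> ('a tmat \<Rightarrow> 'b tmat) \<Rightarrow> bool" where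
  "level_qi_map k G H \<Phi> \<longleftrightarrow>
     \<Phi> ` tspace k \<subseteq> tspace k \<and>
     lin_on k \<Phi> \<and>
     completely_positive k \<Phi> \<and>
     (\<forall>F\<in>QP k. \<forall>X\<in>tspace k. \<Phi> (mhad (hom_tensor G F) X) = mhad (hom_tensor H F) (\<Phi> X)) \<and>
     \<Phi> (mI k) = mI k \<and> adjoint k \<Phi> (mI k) = mI k \<and>
     \<Phi> (mJ k) = mJ k \<and> adjoint k \<Phi> (mJ k) = mJ k \<and>
     (\<forall>F\<in>Qk k. \<Phi> (hom_tensor G F) = hom_tensor H F) \<and>
     (\<forall>\<sigma>\<in>cyc_group k. \<forall>X\<in>tspace k. \<Phi> (pact k \<sigma> X) = pact k \<sigma> (\<Phi> X))"

inductive_set qalg :: "nat \<Rightarrow> ('a \<Rightarrow> 'a \<Rightarrow> bool) \<Rightarrow> 'a tmat set" for k adj where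
  I: "mI k \<in> qalg k adj"
| J: "mJ k \<in> qalg k adj"
| hom: "F \<in> Qk k \<Longrightarrow> hom_tensor adj F \<in> qalg k adj"
| zero: "mzero \<in> qalg k adj"
| add: "A \<in> qalg k adj \<Longrightarrow> B \<in> qalg k adj \<Longrightarrow> madd A B \<in> qalg k adj"
| smult: "A \<in> qalg k adj \<Longrightarrow> msmult c A \<in> qalg k adj"
| mult: "A \<in> qalg k adj \<Longrightarrow> B \<in> qalg k adj \<Longrightarrow> mmult k A B \<in> qalg k adj"
| ctrans: "A \<in> qalg k adj \<Longrightarrow> mctrans A \<in> qalg k adj"
| had: "F \<in> QP k \<Longrightarrow> A \<in> qalg k adj \<Longrightarrow> mhad (hom_tensor adj F) A \<in> qalg k adj"
| perm: "\<sigma> \<in> cyc_group k \<Longrightarrow> A \<in> qalg k adj \<Longrightarrow> pact k \<sigma> A \<in> qalg k adj"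

definition alg_equiv :: "nat \<Rightarrow> ('a \<Rightarrow> 'a \<Rightarrow> bool) \<Rightarrow> ('b \<Rightarrow> 'b \<Rightarrow> bool) \<Rightarrow> bool" where
  "alg_equiv k G H \<longleftrightarrow> (\<exists>\<phi> :: 'a tmat \<Rightarrow> 'b tmat.
     bij_betw \<phi> (qalg k G) (qalg k H) \<and>
     (\<forall>M\<in>qalg k G. \<forall>N\<in>qalg k G. \<forall>c.
        \<phi> (madd M N) = madd (\<phi> M) (\<phi> N) \<and> \<phi> (msmult c M) = msmult c (\<phi> M)) \<and>
     (\<forall>M\<in>qalg k G. \<phi> (mctrans M) = mctrans (\<phi> M)) \<and>
     (\<forall>M\<in>qalg k G. \<forall>N\<in>qalg k G. \<phi> (mmult k M N) = mmult k (\<phi> M) (\<phi> N)) \<and>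
     (\<forall>F\<in>QP k. \<forall>M\<in>qalg k G. \<phi> (mhad (hom_tensor G F) M) = mhad (hom_tensor H F) (\<phi> M)) \<and>
     \<phi> (mI k) = mI k \<and> \<phi> (mJ k) = mJ k \<and>
     (\<forall>F\<in>Qk k. \<phi> (hom_tensor G F) = hom_tensor H F) \<and>
     (\<forall>\<sigma>\<in>cyc_group k. \<forall>M\<in>qalg k G. \<phi> (pact k \<sigma> M) = pact k \<sigma> (\<phi> M)) \<and>
     (\<forall>M\<in>qalg k G. mtrace k (\<phi> M) = mtrace k M))"

end

theory Submission
  imports Defs "HOL-Combinatorics.Cycles"
begin

text \<open>
  From an equivalence \<open>\<phi>\<close> one gets a map \<open>\<Phi> = \<phi> \<circ> E\<close>, where \<open>E\<close> is the orthogonal projection onto the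
  algebra of \<open>G\<close>. For complete positivity, an element of a matrix algebra closed under adjoints is
  positive as soon as its trace pairings with all \<open>C C\<^sup>*\<close>, \<open>C\<close> in the algebra, are non-negative; since
  \<open>\<phi>\<close> preserves products and traces and \<open>E\<close> is self-adjoint, these pairings for \<open>\<Phi>(B)\<close> are pairings
  for \<open>B\<close>.

  Conversely, let \<open>\<Phi>\<close> be a quantum isomorphism map. If \<open>\<Phi>\<close> preserves the norm of \<open>X\<close>, then the Schwarz
  defect \<open>\<Phi>(X\<^sup>* X) - \<Phi>(X)\<^sup>* \<Phi>(X) \<ge> 0\<close> has trace zero and so vanishes, and then
  \<open>\<Phi>(X\<^sup>* Y) = \<Phi>(X)\<^sup>* \<Phi>(Y)\<close> for every \<open>Y\<close>. The set of such \<open>X\<close> is an algebra with all the required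
  closure properties, so it contains the algebra of \<open>G\<close>, on which \<open>\<Phi>\<close> is therefore an equivalence.
\<close>

section \<open>Positive semidefinite matrices over a finite index set\<close>

definition cip :: "'i set \<Rightarrow> ('i \<Rightarrow> complex) \<Rightarrow> ('i \<Rightarrow> complex) \<Rightarrow> complex" where
  "cip S u v = (\<Sum>x\<in>S. cnj (u x) * v x)"

definition qform :: "'i set \<Rightarrow> ('i \<Rightarrow> 'i \<Rightarrow> complex) \<Rightarrow> ('i \<Rightarrow> complex) \<Rightarrow> complex" where
  "qform S Z v = (\<Sum>x\<in>S. \<Sum>y\<in>S. cnj (v x) * Z x y * v y)"

definition psd_on :: "'i set \<Rightarrow> ('i \<Rightarrow> 'i \<Rightarrow> complex) \<Rightarrow> bool" where
  "psd_on S Z \<longleftrightarrow> (\<forall>v. Im (qform S Z v) = 0 \<and> Re (qform S Z v) \<ge> 0)"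

lemma cip_cnj: "cnj (cip S u v) = cip S v u"
  by (simp add: cip_def mult.commute)

lemma cip_add_right: "cip S u (\<lambda>x. v x + w x) = cip S u v + cip S u w"
  by (simp add: cip_def algebra_simps sum.distrib)

lemma cip_diff_right: "cip S u (\<lambda>x. v x - w x) = cip S u v - cip S u w"
  by (simp add: cip_def algebra_simps sum_subtractf)

lemma cip_diff_left: "cip S (\<lambda>x. v x - w x) u = cip S v u - cip S w u"
  by (simp add: cip_def algebra_simps sum_subtractf)

lemma cip_scale_right: "cip S u (\<lambda>x. c * v x) = c * cip S u v"
  by (simp add: cip_def sum_distrib_left algebra_simps)

lemma cip_self: "cip S v v = of_real (\<Sum>x\<in>S. (cmod (v x))\<^sup>2)"
  unfolding cip_def of_real_sum by (simp only: complex_norm_square mult.commute)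

lemma cip_self_eq_0_iff:
  assumes "finite S"
  shows "cip S v v = 0 \<longleftrightarrow> (\<forall>x\<in>S. v x = 0)"
proof -
  have "cip S v v = 0 \<longleftrightarrow> (\<Sum>x\<in>S. (cmod (v x))\<^sup>2) = 0"
    by (simp only: cip_self of_real_eq_0_iff)
  also have "\<dots> \<longleftrightarrow> (\<forall>x\<in>S. v x = 0)"
    using assms by (simp add: sum_nonneg_eq_0_iff)
  finally show ?thesis .
qed

lemma qform_two_points:
  assumes "finite S" "x \<in> S" "y \<in> S" "x \<noteq> y"
  shows "qform S Z (\<lambda>z. if z = x then a else if z = y then b else 0)
       = cnj a * Z x x * a + cnj a * Z x y * b + cnj b * Z y x * a + cnj b * Z y y * b"
proof -
  let ?v = "\<lambda>z. if z = x then a else if z = y then b else 0"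
  have "qform S Z ?v = (\<Sum>z\<in>{x,y}. \<Sum>w\<in>S. cnj (?v z) * Z z w * ?v w)"
    unfolding qform_def using assms by (intro sum.mono_neutral_right) auto
  also have "\<dots> = (\<Sum>z\<in>{x,y}. \<Sum>w\<in>{x,y}. cnj (?v z) * Z z w * ?v w)"
    using assms by (intro sum.cong refl sum.mono_neutral_right) auto
  also have "\<dots> = cnj a * Z x x * a + cnj a * Z x y * b + cnj b * Z y x * a + cnj b * Z y y * b"
    using assms(4) by (auto simp: algebra_simps)
  finally show ?thesis .
qed

lemma qform_point:
  assumes "finite S" "x \<in> S"
  shows "qform S Z (\<lambda>z. if z = x then a else 0) = cnj a * Z x x * a"
proof -
  let ?v = "\<lambda>z. if z = x then a else 0"
  have "qform S Z ?v = (\<Sum>z\<in>{x}. \<Sum>w\<in>S. cnj (?v z) * Z z w * ?v w)"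
    unfolding qform_def using assms by (intro sum.mono_neutral_right) auto
  also have "\<dots> = (\<Sum>z\<in>{x}. \<Sum>w\<in>{x}. cnj (?v z) * Z z w * ?v w)"
    using assms by (intro sum.cong refl sum.mono_neutral_right) auto
  finally show ?thesis by simp
qed

lemma psd_on_diag:
  assumes "finite S" "psd_on S Z" "x \<in> S"
  shows "Im (Z x x) = 0" "Re (Z x x) \<ge> 0"
proof -
  have "Im (qform S Z (\<lambda>z. if z = x then 1 else 0)) = 0"
    "Re (qform S Z (\<lambda>z. if z = x then 1 else 0)) \<ge> 0"
    using assms(2) unfolding psd_on_def by blast+
  then show "Im (Z x x) = 0" "Re (Z x x) \<ge> 0"
    by (simp_all add: qform_point[OF assms(1,3)])
qed

lemma psd_on_hermitian:
  assumes "finite S" "psd_on S Z" "x \<in> S" "y \<in> S"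
  shows "Z y x = cnj (Z x y)"
proof (cases "x = y")
  case True
  then show ?thesis using psd_on_diag(1)[OF assms(1,2,4)] by (simp add: complex_eq_iff)
next
  case False
  have q: "Im (cnj a * Z x x * a + cnj a * Z x y * b + cnj b * Z y x * a + cnj b * Z y y * b) = 0" for a b
    using assms(2) qform_two_points[OF assms(1,3,4) False, of Z a b] unfolding psd_on_def by metis
  have "Im (Z x x) = 0" "Im (Z y y) = 0"
    using psd_on_diag(1)[OF assms(1,2)] assms(3,4) by auto
  \<comment> \<open>The vectors with entries 1, 1 and 1, \<open>\<i>\<close> isolate the imaginary
    part of \<open>Z x y + Z y x\<close> and the real part of \<open>Z x y - Z y x\<close>.\<close>
  with q[of 1 1] q[of 1 \<i>] show ?thesis by (simp add: complex_eq_iff)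
qed

text \<open>With \<open>Z x x = 0\<close>, the form at the vector with entry
  \<open>- s * Z x y\<close> at \<open>x\<close> and 1 at \<open>y\<close> has real part affine in
  the real parameter \<open>s\<close>; it stays nonnegative for all \<open>s\<close> only if its
  slope vanishes.\<close>

lemma psd_on_zero_diag:
  assumes "finite S" "psd_on S Z" "x \<in> S" "y \<in> S" "Z x x = 0"
  shows "Z x y = 0"
proof (cases "x = y")
  case False
  define N where "N = (cmod (Z x y))\<^sup>2"
  have h: "Z y x = cnj (Z x y)" using psd_on_hermitian assms by metis
  have "0 \<le> Re (Z y y) - 2 * s * N" for s :: real
  proof -
    have "0 \<le> Re (qform S Z (\<lambda>z. if z = x then - of_real s * Z x y else if z = y then 1 else 0))"
      using assms(2) unfolding psd_on_def by blast
    also have "\<dots> = Re (Z y y) - 2 * s * N"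
      unfolding qform_two_points[OF assms(1,3,4) False] N_def h cmod_power2 using assms(5)
      by (simp add: algebra_simps power2_eq_square)
    finally show ?thesis .
  qed
  \<comment> \<open>For nonzero \<open>N\<close> this \<open>s\<close> would produce the value
    -1.\<close>
  from this[of "(Re (Z y y) + 1) / (2 * N)"] have "N = 0"
    by (cases "N = 0") auto
  then show ?thesis by (simp add: N_def)
qed (use assms in auto)

lemma qform_hermitian_real:
  assumes "\<And>x y. x \<in> S \<Longrightarrow> y \<in> S \<Longrightarrow> Z y x = cnj (Z x y)"
  shows "Im (qform S Z v) = 0"
proof -
  have "cnj (qform S Z v) = (\<Sum>x\<in>S. \<Sum>y\<in>S. cnj (v y) * Z y x * v x)"
    unfolding qform_def cnj_sum
  proof (intro sum.cong refl)
    fix x y assume "x \<in> S" "y \<in> S"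
    then show "cnj (cnj (v x) * Z x y * v y) = cnj (v y) * Z y x * v x"
      by (subst assms) (auto simp: algebra_simps)
  qed
  also have "\<dots> = qform S Z v" unfolding qform_def by (rule sum.swap)
  finally show ?thesis by (metis Im_complex_of_real Reals_cnj_iff complex_is_Real_iff)
qed

text \<open>A crude bound on the largest eigenvalue; it has to supply a constant \<open>c\<close>
  for which \<open>1 - Z / c\<close> is positive.\<close>

lemma Re_qform_le:
  assumes "finite S"
  shows "Re (qform S Z v) \<le> (\<Sum>x\<in>S. \<Sum>y\<in>S. cmod (Z x y)) * Re (cip S v v)"
proof -
  define N where "N = (\<Sum>x\<in>S. (cmod (v x))\<^sup>2)"
  have N: "(cmod (v x))\<^sup>2 \<le> N" if "x \<in> S" for x
    unfolding N_def using assms that by (intro member_le_sum) auto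
  have p: "cmod (v x) * cmod (v y) \<le> N" if "x \<in> S" "y \<in> S" for x y
  proof -
    have "2 * (cmod (v x) * cmod (v y)) \<le> (cmod (v x))\<^sup>2 + (cmod (v y))\<^sup>2"
      using sum_squares_bound[of "cmod (v x)" "cmod (v y)"] by (simp add: algebra_simps)
    with N[OF that(1)] N[OF that(2)] show ?thesis by linarith
  qed
  have "Re (qform S Z v) \<le> (\<Sum>x\<in>S. \<Sum>y\<in>S. cmod (cnj (v x) * Z x y * v y))"
    unfolding qform_def Re_sum by (intro sum_mono complex_Re_le_cmod)
  also have "\<dots> \<le> (\<Sum>x\<in>S. \<Sum>y\<in>S. cmod (Z x y) * N)"
  proof (intro sum_mono)
    fix x y assume "x \<in> S" "y \<in> S"
    from mult_left_mono[OF p[OF this], of "cmod (Z x y)"]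
    show "cmod (cnj (v x) * Z x y * v y) \<le> cmod (Z x y) * N"
      by (simp add: norm_mult algebra_simps)
  qed
  also have "\<dots> = (\<Sum>x\<in>S. \<Sum>y\<in>S. cmod (Z x y)) * Re (cip S v v)"
    by (simp add: cip_self N_def sum_distrib_right)
  finally show ?thesis .
qed

text \<open>Instead of diagonalising, apply the test to the powers \<open>C = R^m\<close> of \<open>R = 1 - Z / c \<ge> 0\<close>:
  it makes the traces of the powers of \<open>R\<close> non-increasing, whereas a vector \<open>v\<close> with
  \<open>\<langle>v, R v\<rangle> > \<langle>v, v\<rangle>\<close> would make the traces of \<open>R^(2^i)\<close> unbounded.\<close>
lemma psd_on_if_trace_tests:
  fixes Z :: "'i \<Rightarrow> 'i \<Rightarrow> complex"
  assumes fin: "finite S"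
    and herm: "\<And>x y. x \<in> S \<Longrightarrow> y \<in> S \<Longrightarrow> Z y x = cnj (Z x y)"
    and U: "U \<in> B" "\<And>x y. x \<in> S \<Longrightarrow> y \<in> S \<Longrightarrow> U x y = (if x = y then 1 else 0)"
    and Z: "Z \<in> B"
    and lin: "\<And>C D c. C \<in> B \<Longrightarrow> D \<in> B \<Longrightarrow> (\<lambda>x y. C x y + c * D x y) \<in> B"
    and mult: "\<And>C D. C \<in> B \<Longrightarrow> D \<in> B \<Longrightarrow> (\<lambda>x y. \<Sum>z\<in>S. C x z * D z y) \<in> B"
    and test: "\<And>C. C \<in> B \<Longrightarrow> 0 \<le> Re (\<Sum>y\<in>S. qform S Z (\<lambda>x. C x y))"
  shows "psd_on S Z"
proof -
  \<comment> \<open>The summand 1 keeps \<open>c\<close> positive even for \<open>Z = 0\<close>, so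
    dividing by \<open>c\<close> preserves signs.\<close>
  define c where "c = 1 + (\<Sum>x\<in>S. \<Sum>y\<in>S. cmod (Z x y))"
  have c1: "c \<ge> 1" unfolding c_def by (simp add: sum_nonneg)
  define R where "R = (\<lambda>x y. U x y + of_real (-1 / c) * Z x y)"
  have RB: "R \<in> B" unfolding R_def by (rule lin[OF U(1) Z])
  define L where "L = (\<lambda>v x. \<Sum>z\<in>S. R x z * v z)"
  have LSuc: "(L ^^ Suc j) u x = (\<Sum>z\<in>S. R x z * (L ^^ j) u z)" for j u x
    by (simp add: L_def)
  \<comment> \<open>\<open>U\<close> is known to be the identity on \<open>S\<close> only. Starting
    from its columns, instead of from unit vectors, makes the matrix with columns
    \<open>(L ^^ m) (e y)\<close> a product of members of \<open>B\<close>, hence itself a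
    member.\<close>
  define e where "e = (\<lambda>y x. U x y)"
  have eS: "e y x = (if x = y then 1 else 0)" if "x \<in> S" "y \<in> S" for x y
    using U(2) that by (simp add: e_def)
  have LB: "(\<lambda>x y. (L ^^ m) (e y) x) \<in> B" for m
  proof (induction m)
    case 0 then show ?case using U(1) by (simp add: e_def)
  next
    case (Suc m)
    from mult[OF RB Suc] show ?case by (simp only: LSuc)
  qed
  have Rh: "R y x = cnj (R x y)" if "x \<in> S" "y \<in> S" for x y
    using herm[OF that] U(2) that by (simp add: R_def)
  have Lsym: "cip S (L u) v = cip S u (L v)" for u v
  proof -
    have "cip S (L u) v = (\<Sum>x\<in>S. \<Sum>z\<in>S. cnj (R x z) * cnj (u z) * v x)"
      by (simp add: cip_def L_def sum_distrib_right)
    also have "\<dots> = (\<Sum>x\<in>S. \<Sum>z\<in>S. R z x * cnj (u z) * v x)"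
      by (intro sum.cong refl, subst Rh) auto
    also have "\<dots> = (\<Sum>z\<in>S. \<Sum>x\<in>S. R z x * cnj (u z) * v x)" by (rule sum.swap)
    also have "\<dots> = cip S u (L v)"
      by (simp add: cip_def L_def sum_distrib_left algebra_simps)
    finally show ?thesis .
  qed
  have Lpow: "cip S ((L ^^ m) u) v = cip S u ((L ^^ m) v)" for m u v
  proof (induction m arbitrary: v)
    case (Suc m)
    have "cip S ((L ^^ Suc m) u) v = cip S u ((L ^^ m) (L v))" by (simp add: Lsym Suc)
    then show ?case by (simp add: funpow_swap1)
  qed simp
  have shift: "cip S ((L ^^ m) u) ((L ^^ j) v) = cip S u ((L ^^ (m + j)) v)" for m j u v
    by (simp add: Lpow funpow_add)
  have Lq: "cip S v (L v) = cip S v v - of_real (1 / c) * qform S Z v" for v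
  proof -
    have "cip S v (L v) = (\<Sum>x\<in>S. \<Sum>z\<in>S. cnj (v x) * U x z * v z
        - of_real (1 / c) * (cnj (v x) * Z x z * v z))"
      by (simp add: cip_def L_def R_def sum_distrib_left algebra_simps)
    also have "\<dots> = (\<Sum>x\<in>S. \<Sum>z\<in>S. cnj (v x) * U x z * v z) - of_real (1 / c) * qform S Z v"
      by (simp add: sum_subtractf qform_def sum_distrib_left)
    also have "(\<Sum>x\<in>S. \<Sum>z\<in>S. cnj (v x) * U x z * v z) = cip S v v"
    proof -
      have "(\<Sum>z\<in>S. cnj (v x) * U x z * v z) = cnj (v x) * v x" if "x \<in> S" for x
      proof -
        have "(\<Sum>z\<in>S. cnj (v x) * U x z * v z) = (\<Sum>z\<in>S. if z = x then cnj (v x) * v x else 0)"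
          using U(2) that by (intro sum.cong) auto
        then show ?thesis using fin that by simp
      qed
      then show ?thesis by (simp add: cip_def)
    qed
    finally show ?thesis .
  qed
  have Lpos: "0 \<le> Re (cip S v (L v))" for v
  proof -
    have v0: "0 \<le> Re (cip S v v)" by (simp add: cip_self sum_nonneg)
    have "Re (qform S Z v) \<le> c * Re (cip S v v)"
      using Re_qform_le[OF fin, of Z v] v0 by (simp add: c_def algebra_simps)
    then have "Re (qform S Z v) / c \<le> Re (cip S v v)"
      using c1 by (simp add: field_simps)
    then show ?thesis by (simp add: Lq)
  qed
  \<comment> \<open>\<open>a j\<close> is the real part of the trace of \<open>R^j\<close> over
    \<open>S\<close>.\<close>
  define a where "a = (\<lambda>j. \<Sum>y\<in>S. Re (cip S (e y) ((L ^^ j) (e y))))"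
  \<comment> \<open>The test on \<open>C = R^m\<close> says that
    \<open>c * (tr R^(2m) - tr R^(2m+1))\<close> is nonnegative.\<close>
  have odd_le: "a (2 * m + 1) \<le> a (2 * m)" for m
  proof -
    have "0 \<le> Re (\<Sum>y\<in>S. qform S Z ((L ^^ m) (e y)))"
      using test[OF LB[of m]] by simp
    moreover have "Re (qform S Z v) = c * (Re (cip S v v) - Re (cip S v (L v)))" for v
      using c1 by (simp add: Lq)
    ultimately have "0 \<le> c * (\<Sum>y\<in>S. Re (cip S ((L ^^ m) (e y)) ((L ^^ m) (e y)))
        - Re (cip S ((L ^^ m) (e y)) ((L ^^ Suc m) (e y))))"
      by (simp add: sum_distrib_left)
    also have "\<dots> = c * (a (2 * m) - a (2 * m + 1))"
      unfolding shift a_def sum_subtractf by (simp add: mult_2)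
    finally show ?thesis using c1 by (simp add: zero_le_mult_iff)
  qed
  \<comment> \<open>The number is the trace of \<open>R (R^m - R^(m+1))^2\<close>, nonnegative
    because \<open>R\<close> is. Together with \<open>odd_le\<close> for \<open>m\<close> and
    \<open>m + 1\<close> it gives the remaining comparison, of an odd power with the next even
    one.\<close>
  have conv: "0 \<le> a (2 * m + 1) - 2 * a (2 * m + 2) + a (2 * m + 3)" for m
  proof -
    let ?w = "\<lambda>j y. (L ^^ j) (e y)"
    have idx: "m + Suc m = 2 * m + 1" "Suc m + Suc m = 2 * m + 2"
      "m + Suc (Suc m) = 2 * m + 2" "Suc m + Suc (Suc m) = 2 * m + 3" by simp_all
    have "0 \<le> (\<Sum>y\<in>S. Re (cip S (\<lambda>x. ?w m y x - ?w (Suc m) y x) (L (\<lambda>x. ?w m y x - ?w (Suc m) y x))))"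
      by (intro sum_nonneg Lpos)
    moreover have "L (\<lambda>x. ?w m y x - ?w (Suc m) y x) = (\<lambda>x. ?w (Suc m) y x - ?w (Suc (Suc m)) y x)" for y
      by (simp add: L_def algebra_simps sum_subtractf)
    moreover have "(\<Sum>y\<in>S. Re (cip S (\<lambda>x. ?w m y x - ?w (Suc m) y x)
        (\<lambda>x. ?w (Suc m) y x - ?w (Suc (Suc m)) y x))) = a (2 * m + 1) - 2 * a (2 * m + 2) + a (2 * m + 3)"
      unfolding cip_diff_left cip_diff_right shift a_def idx minus_complex.simps sum_subtractf
      by linarith
    ultimately show ?thesis by (simp only:)
  qed
  have a_le: "a (2 * m) \<le> a 0" for m
  proof (induction m)
    case (Suc m)
    have "a (2 * m + 3) \<le> a (2 * m + 2)" using odd_le[of "Suc m"] by (simp add: numeral_eq_Suc)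
    with conv[of m] odd_le[of m] Suc show ?case by simp
  qed simp
  have expand: "(L ^^ j) v x = (\<Sum>y\<in>S. v y * (L ^^ j) (e y) x)" if "x \<in> S" for j v x
    using that
  proof (induction j arbitrary: x)
    case 0
    have "(\<Sum>y\<in>S. v y * e y x) = (\<Sum>y\<in>S. if y = x then v x else 0)"
      using eS 0 by (intro sum.cong) auto
    then show ?case using 0 fin by simp
  next
    case (Suc j)
    have "(L ^^ Suc j) v x = (\<Sum>z\<in>S. \<Sum>y\<in>S. R x z * (v y * (L ^^ j) (e y) z))"
      unfolding LSuc by (intro sum.cong refl) (simp add: Suc.IH sum_distrib_left)
    also have "\<dots> = (\<Sum>y\<in>S. \<Sum>z\<in>S. R x z * (v y * (L ^^ j) (e y) z))" by (rule sum.swap)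
    also have "\<dots> = (\<Sum>y\<in>S. v y * (L ^^ Suc j) (e y) x)"
      unfolding LSuc sum_distrib_left by (simp only: mult.left_commute)
    finally show ?case .
  qed
  \<comment> \<open>Cauchy-Schwarz bounds the norm of \<open>R^j v\<close> by the norm of
    \<open>v\<close> times the Hilbert-Schmidt norm of \<open>R^j\<close>, whose square is
    \<open>a (2 * j)\<close>.\<close>
  have bound: "Re (cip S ((L ^^ j) v) ((L ^^ j) v)) \<le> Re (cip S v v) * a 0" for j v
  proof -
    let ?w = "\<lambda>y. (L ^^ j) (e y)"
    have "(cmod ((L ^^ j) v x))\<^sup>2 \<le> (\<Sum>y\<in>S. (cmod (v y))\<^sup>2) * (\<Sum>y\<in>S. (cmod (?w y x))\<^sup>2)"
      if "x \<in> S" for x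
    proof -
      have "cmod ((L ^^ j) v x) \<le> (\<Sum>y\<in>S. cmod (v y) * cmod (?w y x))"
        by (subst expand[OF that], rule order_trans[OF norm_sum]) (simp add: norm_mult)
      then have "(cmod ((L ^^ j) v x))\<^sup>2 \<le> (\<Sum>y\<in>S. cmod (v y) * cmod (?w y x))\<^sup>2"
        by (intro power_mono) auto
      also have "\<dots> \<le> (\<Sum>y\<in>S. (cmod (v y))\<^sup>2) * (\<Sum>y\<in>S. (cmod (?w y x))\<^sup>2)"
        by (rule Cauchy_Schwarz_ineq_sum)
      finally show ?thesis .
    qed
    then have "Re (cip S ((L ^^ j) v) ((L ^^ j) v))
        \<le> (\<Sum>x\<in>S. (\<Sum>y\<in>S. (cmod (v y))\<^sup>2) * (\<Sum>y\<in>S. (cmod (?w y x))\<^sup>2))"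
      unfolding cip_self Re_complex_of_real by (intro sum_mono)
    also have "\<dots> = Re (cip S v v) * (\<Sum>y\<in>S. \<Sum>x\<in>S. (cmod (?w y x))\<^sup>2)"
      unfolding cip_self Re_complex_of_real sum_distrib_left[symmetric] by (subst sum.swap) rule
    also have "(\<Sum>y\<in>S. \<Sum>x\<in>S. (cmod (?w y x))\<^sup>2) = (\<Sum>y\<in>S. Re (cip S (?w y) (?w y)))"
      unfolding cip_self Re_complex_of_real ..
    also have "\<dots> = a (2 * j)" unfolding shift a_def by (simp add: mult_2)
    also have "Re (cip S v v) * a (2 * j) \<le> Re (cip S v v) * a 0"
      using a_le[of j] by (intro mult_left_mono) (auto simp: cip_self sum_nonneg)
    finally show ?thesis .
  qed
  have main: "Re (cip S v (L v)) \<le> Re (cip S v v)" for v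
  proof (rule ccontr)
    assume neg: "\<not> ?thesis"
    define N where "N = Re (cip S v v)"
    have Nsum: "N = (\<Sum>x\<in>S. (cmod (v x))\<^sup>2)" by (simp add: N_def cip_self)
    have N0: "N \<ge> 0" by (simp add: Nsum sum_nonneg)
    have cs: "(Re (cip S v u))\<^sup>2 \<le> N * Re (cip S u u)" for u
    proof -
      have "cmod (cip S v u) \<le> (\<Sum>x\<in>S. cmod (v x) * cmod (u x))"
        unfolding cip_def by (rule order_trans[OF norm_sum]) (simp add: norm_mult)
      then have "\<bar>Re (cip S v u)\<bar> \<le> (\<Sum>x\<in>S. cmod (v x) * cmod (u x))"
        using abs_Re_le_cmod order_trans by blast
      then have "\<bar>Re (cip S v u)\<bar>\<^sup>2 \<le> (\<Sum>x\<in>S. cmod (v x) * cmod (u x))\<^sup>2"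
        by (intro power_mono) auto
      also have "\<dots> \<le> (\<Sum>x\<in>S. (cmod (v x))\<^sup>2) * (\<Sum>x\<in>S. (cmod (u x))\<^sup>2)"
        by (rule Cauchy_Schwarz_ineq_sum)
      finally show ?thesis by (simp add: Nsum cip_self)
    qed
    have "N \<noteq> 0"
    proof
      assume "N = 0"
      with cs[of "L v"] neg show False by (simp add: N_def)
    qed
    with N0 have Npos: "N > 0" by simp
    \<comment> \<open>\<open>r j\<close> is the Rayleigh quotient of \<open>R^j\<close> at
      \<open>v\<close>. By Cauchy-Schwarz for \<open>v\<close> and \<open>R^j v\<close>, doubling
      the exponent at least squares it.\<close>
    define r where "r = (\<lambda>j. Re (cip S v ((L ^^ j) v)) / N)"
    have r1: "r 1 > 1" using neg Npos by (simp add: r_def N_def field_simps)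
    have double: "(r j)\<^sup>2 \<le> r (2 * j)" for j
    proof -
      have "(Re (cip S v ((L ^^ j) v)))\<^sup>2 \<le> N * Re (cip S v ((L ^^ (2 * j)) v))"
        using cs[of "(L ^^ j) v"] unfolding shift by (simp add: mult_2)
      then show ?thesis using Npos by (simp add: r_def field_simps power2_eq_square)
    qed
    have pow: "r 1 ^ (2 ^ i) \<le> r (2 ^ i)" for i
    proof (induction i)
      case (Suc i)
      have "r 1 ^ (2 ^ Suc i) = (r 1 ^ (2 ^ i))\<^sup>2" by (simp add: power_mult[symmetric] mult.commute)
      also have "\<dots> \<le> (r (2 ^ i))\<^sup>2" using Suc r1 by (intro power_mono) auto
      also have "\<dots> \<le> r (2 ^ Suc i)" using double[of "2 ^ i"] by simp
      finally show ?case .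
    qed simp
    have up: "r (2 * j) \<le> a 0" for j
    proof -
      have "Re (cip S v ((L ^^ (2 * j)) v)) \<le> N * a 0"
        using bound[of j v] unfolding shift by (simp add: mult_2 N_def)
      then show ?thesis using Npos by (simp add: r_def field_simps)
    qed
    \<comment> \<open>The exponent \<open>2 ^ Suc i\<close> used next exceeds \<open>i\<close>, and
      it is even, as the upper bound \<open>up\<close> requires.\<close>
    obtain i where i: "a 0 < r 1 ^ i" using real_arch_pow[OF r1] by blast
    have "r 1 ^ i \<le> r 1 ^ (2 ^ Suc i)"
      using r1 less_exp[of "Suc i"] by (intro power_increasing) (auto intro: less_imp_le)
    also have "\<dots> \<le> a 0" using pow[of "Suc i"] up[of "2 ^ i"] by simp
    finally show False using i by simp
  qed
  show ?thesis unfolding psd_on_def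
  proof (intro allI conjI)
    fix v
    show "Im (qform S Z v) = 0" by (rule qform_hermitian_real) (rule herm)
    have "Re (qform S Z v) / c \<ge> 0" using main[of v] by (simp add: Lq)
    then show "Re (qform S Z v) \<ge> 0" using c1 by (simp add: zero_le_divide_iff)
  qed
qed

text \<open>Induction on the support \<open>T\<close>. Requiring the value 0 at one more point
  \<open>s\<close> cuts \<open>W\<close> down to a subspace \<open>W'\<close> of codimension at most
  one; if it is proper, adding the component along one vector \<open>d\<close> of \<open>W\<close>
  orthogonal to \<open>W'\<close> completes the projection.\<close>

lemma orthogonal_projection_exists:
  fixes W :: "('i \<Rightarrow> complex) set"
  assumes "finite S" "finite T" "T \<subseteq> S"
    and "(\<lambda>x. 0) \<in> W"
    and "\<And>A B c. A \<in> W \<Longrightarrow> B \<in> W \<Longrightarrow> (\<lambda>x. A x + c * B x) \<in> W"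
    and "\<And>A x. A \<in> W \<Longrightarrow> x \<notin> T \<Longrightarrow> A x = 0"
  shows "\<exists>Y\<in>W. \<forall>A\<in>W. cip S A (\<lambda>x. X x - Y x) = 0"
  using assms(2-)
proof (induction T arbitrary: W X rule: finite_induct)
  case empty
  have "cip S A u = 0" if "A \<in> W" for A u
  proof -
    have "A x = 0" for x using empty(4)[OF that] by simp
    then show ?thesis by (simp add: cip_def)
  qed
  with empty(2) show ?case by blast
next
  case (insert s T)
  note W = insert.prems
  define W' where "W' = {A \<in> W. A s = 0}"
  have T: "T \<subseteq> S" using W(1) by auto
  have W': "(\<lambda>x. 0) \<in> W'" "\<And>A B c. A \<in> W' \<Longrightarrow> B \<in> W' \<Longrightarrow> (\<lambda>x. A x + c * B x) \<in> W'"
    "\<And>A x. A \<in> W' \<Longrightarrow> x \<notin> T \<Longrightarrow> A x = 0"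
    using W(2,3) W(4)[of _ _] unfolding W'_def by auto metis
  have IH: "\<exists>Y\<in>W'. \<forall>A\<in>W'. cip S A (\<lambda>x. X x - Y x) = 0" for X
    using T W' by (rule insert.IH)
  show ?case
  proof (cases "W' = W")
    case True
    then show ?thesis using IH by simp
  next
    case False
    then obtain a where a: "a \<in> W" "a s \<noteq> 0" unfolding W'_def by blast
    obtain b where b: "b \<in> W'" "\<forall>A\<in>W'. cip S A (\<lambda>x. a x - b x) = 0" using IH[of a] by blast
    \<comment> \<open>\<open>b\<close> is the projection of \<open>a\<close> to \<open>W'\<close>,
      so \<open>d\<close> is orthogonal to \<open>W'\<close>, and \<open>d s = a s\<close> is
      nonzero.\<close>
    define d where "d = (\<lambda>x. a x - b x)"
    have dW: "d \<in> W" using W(3)[OF a(1), of b "-1"] b(1) by (simp add: d_def W'_def)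
    have ds: "d s \<noteq> 0" using a b by (simp add: d_def W'_def)
    have dorth: "cip S A d = 0" if "A \<in> W'" for A using b(2) that by (simp add: d_def)
    have dorth': "cip S d A = 0" if "A \<in> W'" for A using dorth[OF that] by (metis cip_cnj complex_cnj_zero)
    obtain Y where Y: "Y \<in> W'" "\<forall>A\<in>W'. cip S A (\<lambda>x. X x - Y x) = 0" using IH[of X] by blast
    have dd: "cip S d d \<noteq> 0" using ds W(1) by (auto simp: cip_self_eq_0_iff[OF assms(1)])
    define t where "t = cip S d X / cip S d d"
    define Y' where "Y' = (\<lambda>x. Y x + t * d x)"
    have Y'W: "Y' \<in> W" using W(3)[OF _ dW] Y(1) by (simp add: Y'_def W'_def)
    have split: "cip S A (\<lambda>x. X x - Y' x) = cip S A (\<lambda>x. X x - Y x) - t * cip S A d" for A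
      unfolding Y'_def cip_diff_right cip_add_right cip_scale_right by simp
    have o1: "cip S A (\<lambda>x. X x - Y' x) = 0" if "A \<in> W'" for A
      using Y(2) dorth that by (simp add: split)
    have o2: "cip S d (\<lambda>x. X x - Y' x) = 0"
      using dd dorth'[OF Y(1)] by (subst split) (simp add: cip_diff_right t_def)
    have "cip S A (\<lambda>x. X x - Y' x) = 0" if A: "A \<in> W" for A
    proof -
      \<comment> \<open>The multiple \<open>q * d\<close> has the value of \<open>A\<close> at
        \<open>s\<close>, so the difference lies in \<open>W'\<close>.\<close>
      define q where "q = A s / d s"
      have "(\<lambda>x. A x - q * d x) \<in> W" using W(3)[OF A dW, of "- q"] by simp
      then have "(\<lambda>x. A x - q * d x) \<in> W'" using ds by (simp add: W'_def q_def)
      from o1[OF this] have "cip S A (\<lambda>x. X x - Y' x) = cip S (\<lambda>x. q * d x) (\<lambda>x. X x - Y' x)"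
        by (simp add: cip_diff_left)
      also have "\<dots> = cnj q * cip S d (\<lambda>x. X x - Y' x)"
        by (simp add: cip_def sum_distrib_left algebra_simps)
      finally show ?thesis using o2 by simp
    qed
    then show ?thesis using Y'W by blast
  qed
qed

section \<open>Matrices indexed by tuples\<close>

lemma finite_tuples [simp]: "finite (tuples k :: 'a::finite list set)"
  using finite_lists_length_eq[of "UNIV :: 'a set" k] by (simp add: tuples_def)

lemma card_tuples: "card (tuples k :: 'a::finite list set) = CARD('a) ^ k"
  using card_lists_length_eq[of "UNIV :: 'a set" k] by (simp add: tuples_def)

lemma tspace_eqI:
  assumes "A \<in> tspace k" "B \<in> tspace k"
    and "\<And>x y. x \<in> tuples k \<Longrightarrow> y \<in> tuples k \<Longrightarrow> A x y = B x y"
  shows "A = B"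
proof (intro ext)
  fix x y show "A x y = B x y"
    using assms by (cases "length x = k \<and> length y = k") (auto simp: tspace_def tuples_def)
qed

lemma tspace_madd: "A \<in> tspace k \<Longrightarrow> B \<in> tspace k \<Longrightarrow> madd A B \<in> tspace k"
  by (simp add: tspace_def madd_def)

lemma tspace_msmult: "A \<in> tspace k \<Longrightarrow> msmult c A \<in> tspace k"
  by (simp add: tspace_def msmult_def)

lemma tspace_mzero: "mzero \<in> tspace k"
  by (simp add: tspace_def mzero_def)

lemma tspace_mI: "mI k \<in> tspace k"
  by (auto simp: tspace_def mI_def)

lemma tspace_mJ: "mJ k \<in> tspace k"
  by (auto simp: tspace_def mJ_def)

lemma tspace_mmult: "A \<in> tspace k \<Longrightarrow> B \<in> tspace k \<Longrightarrow> mmult k A B \<in> tspace k"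
  by (auto simp: tspace_def mmult_def intro!: sum.neutral)

lemma tspace_mctrans: "A \<in> tspace k \<Longrightarrow> mctrans A \<in> tspace k"
  by (auto simp: tspace_def mctrans_def)

lemma tspace_mhad: "B \<in> tspace k \<Longrightarrow> mhad A B \<in> tspace k"
  by (auto simp: tspace_def mhad_def)

lemma tspace_pact: "pact k \<sigma> A \<in> tspace k"
  by (auto simp: tspace_def pact_def)

lemma tspace_munit: "x \<in> tuples k \<Longrightarrow> y \<in> tuples k \<Longrightarrow> munit x y \<in> tspace k"
  by (auto simp: tspace_def munit_def tuples_def)

lemmas tspace_intros = tspace_madd tspace_msmult tspace_mzero tspace_mI tspace_mJ tspace_mmult
  tspace_mctrans tspace_mhad tspace_pact

lemma mmult_assoc: "mmult k (mmult k A B) C = mmult k A (mmult k B C)"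
proof (intro ext)
  fix x y
  have "mmult k (mmult k A B) C x y = (\<Sum>z\<in>tuples k. \<Sum>w\<in>tuples k. A x w * B w z * C z y)"
    by (simp add: mmult_def sum_distrib_right)
  also have "\<dots> = (\<Sum>w\<in>tuples k. \<Sum>z\<in>tuples k. A x w * B w z * C z y)" by (rule sum.swap)
  also have "\<dots> = mmult k A (mmult k B C) x y"
    by (simp add: mmult_def sum_distrib_left mult.assoc)
  finally show "mmult k (mmult k A B) C x y = mmult k A (mmult k B C) x y" .
qed

lemma mctrans_mctrans [simp]: "mctrans (mctrans A) = A"
  by (simp add: mctrans_def)

lemma mctrans_mmult: "mctrans (mmult k A B) = mmult k (mctrans B) (mctrans A)"
  by (simp add: mctrans_def mmult_def mult.commute)

lemma mctrans_mI [simp]: "mctrans (mI k) = mI k"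
  by (auto simp: mctrans_def mI_def fun_eq_iff)

lemma mmult_mI_left:
  fixes A :: "'a::finite tmat"
  assumes "A \<in> tspace k"
  shows "mmult k (mI k) A = A"
proof (rule tspace_eqI[OF _ assms])
  fix x y :: "'a list" assume x: "x \<in> tuples k"
  have "mmult k (mI k) A x y = (\<Sum>z\<in>tuples k. if z = x then A x y else 0)"
    unfolding mmult_def by (intro sum.cong) (auto simp: mI_def tuples_def)
  then show "mmult k (mI k) A x y = A x y" using x by simp
qed (use assms in \<open>intro tspace_intros\<close>)

lemma mmult_mI_right:
  fixes A :: "'a::finite tmat"
  assumes "A \<in> tspace k"
  shows "mmult k A (mI k) = A"
  using mmult_mI_left[OF tspace_mctrans[OF assms]]
  by (metis mctrans_mctrans mctrans_mI mctrans_mmult)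

section \<open>Trace and trace inner product\<close>

lemma mtrace_mmult_commute: "mtrace k (mmult k A B) = mtrace k (mmult k B A)"
  unfolding mtrace_def mmult_def by (subst sum.swap) (simp add: mult.commute)

lemma tinner_cip:
  "tinner k A B = cip (tuples k \<times> tuples k) (\<lambda>(x, y). A x y) (\<lambda>(x, y). B x y)"
proof -
  have "tinner k A B = (\<Sum>x\<in>tuples k. \<Sum>z\<in>tuples k. cnj (A z x) * B z x)"
    by (simp add: tinner_def mtrace_def mmult_def mctrans_def)
  also have "\<dots> = (\<Sum>z\<in>tuples k. \<Sum>x\<in>tuples k. cnj (A z x) * B z x)" by (rule sum.swap)
  finally show ?thesis by (simp add: cip_def sum.cartesian_product case_prod_beta)
qed

lemma tinner_cnj: "cnj (tinner k A B) = tinner k B A"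
  by (simp add: tinner_cip cip_cnj)

lemma tinner_madd_left: "tinner k (madd A B) C = tinner k A C + tinner k B C"
  by (simp add: tinner_cip cip_def madd_def case_prod_beta algebra_simps sum.distrib)

lemma tinner_madd_right: "tinner k C (madd A B) = tinner k C A + tinner k C B"
  by (simp add: tinner_cip cip_def madd_def case_prod_beta algebra_simps sum.distrib)

lemma tinner_msmult_left: "tinner k (msmult c A) C = cnj c * tinner k A C"
  by (simp add: tinner_cip cip_def msmult_def case_prod_beta algebra_simps sum_distrib_left)

lemma tinner_msmult_right: "tinner k C (msmult c A) = c * tinner k C A"
  by (simp add: tinner_cip cip_def msmult_def case_prod_beta algebra_simps sum_distrib_left)

lemma tinner_mmult_left: "tinner k (mmult k A B) C = tinner k B (mmult k (mctrans A) C)"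
  by (simp add: tinner_def mctrans_mmult mmult_assoc)

lemma tinner_mctrans: "tinner k (mctrans A) (mctrans B) = tinner k B A"
  by (simp add: tinner_def mtrace_mmult_commute)

lemma tinner_mI: "tinner k (mI k) (A :: 'a::finite tmat) = mtrace k A"
proof -
  have "tinner k (mI k) A = (\<Sum>x\<in>tuples k. \<Sum>y\<in>tuples k. cnj (mI k x y) * A x y)"
    by (simp add: tinner_cip cip_def sum.cartesian_product case_prod_beta)
  also have "\<dots> = (\<Sum>x\<in>tuples k. \<Sum>y\<in>tuples k. if y = x then A x x else 0)"
    by (intro sum.cong) (auto simp: mI_def tuples_def)
  finally show ?thesis by (simp add: mtrace_def)
qed

lemma tinner_self_eq_0:
  fixes A :: "'a::finite tmat"
  assumes "A \<in> tspace k" "tinner k A A = 0"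
  shows "A = mzero"
proof (rule tspace_eqI[OF assms(1) tspace_mzero])
  fix x y :: "'a list" assume "x \<in> tuples k" "y \<in> tuples k"
  with assms(2) show "A x y = mzero x y"
    by (auto simp: tinner_cip cip_self_eq_0_iff mzero_def)
qed

lemma tinner_mhad:
  assumes "\<And>x y. cnj (P x y) = P x y"
  shows "tinner k (mhad P A) B = tinner k A (mhad P B)"
  using assms by (simp add: tinner_cip cip_def mhad_def case_prod_beta algebra_simps)

section \<open>Block matrices over tuples\<close>

lemma block_psd_iff:
  "block_psd k n B \<longleftrightarrow> psd_on ({..<n} \<times> tuples k) (\<lambda>(i, x) (j, y). B i j x y)"
proof -
  have q: "qform ({..<n} \<times> tuples k) (\<lambda>(i, x) (j, y). B i j x y) (\<lambda>(i, x). v i x)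
    = (\<Sum>i<n. \<Sum>j<n. \<Sum>x\<in>tuples k. \<Sum>y\<in>tuples k. cnj (v i x) * B i j x y * v j y)" for v
  proof -
    have "qform ({..<n} \<times> tuples k) (\<lambda>(i, x) (j, y). B i j x y) (\<lambda>(i, x). v i x)
      = (\<Sum>i<n. \<Sum>x\<in>tuples k. \<Sum>j<n. \<Sum>y\<in>tuples k. cnj (v i x) * B i j x y * v j y)"
      by (simp add: qform_def sum.cartesian_product')
    also have "\<dots> = (\<Sum>i<n. \<Sum>j<n. \<Sum>x\<in>tuples k. \<Sum>y\<in>tuples k. cnj (v i x) * B i j x y * v j y)"
      by (intro sum.cong refl sum.swap)
    finally show ?thesis .
  qed
  have "(\<forall>v. P v) \<longleftrightarrow> (\<forall>v. P (\<lambda>(i, x). v i x))" for P :: "(nat \<times> 'a list \<Rightarrow> complex) \<Rightarrow> bool"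
    by (metis case_prod_curry)
  then show ?thesis unfolding block_psd_def psd_on_def Let_def q[symmetric] by simp
qed

text \<open>The form of this block matrix at \<open>v\<close> is the squared norm of the sum of all
  \<open>C j\<close> applied to \<open>v j\<close>.\<close>

lemma block_psd_gram:
  "block_psd k n (\<lambda>i j. mmult k (mctrans (C i)) (C j))"
proof -
  have "(\<Sum>i<n. \<Sum>j<n. \<Sum>x\<in>tuples k. \<Sum>y\<in>tuples k. cnj (v i x) * mmult k (mctrans (C i)) (C j) x y * v j y)
    = cip (tuples k) (\<lambda>z. \<Sum>j<n. \<Sum>y\<in>tuples k. C j z y * v j y) (\<lambda>z. \<Sum>j<n. \<Sum>y\<in>tuples k. C j z y * v j y)"
    (is "?l = ?r") for v
  proof -
    let ?S = "{..<n} \<times> tuples k"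
    define f where "f = (\<lambda>z p. C (fst p) z (snd p) * v (fst p) (snd p))"
    have "?r = (\<Sum>z\<in>tuples k. cnj (\<Sum>p\<in>?S. f z p) * (\<Sum>p\<in>?S. f z p))"
      by (simp add: cip_def f_def sum.cartesian_product case_prod_beta)
    also have "\<dots> = (\<Sum>z\<in>tuples k. \<Sum>p\<in>?S. \<Sum>q\<in>?S. cnj (f z p) * f z q)"
      by (simp add: sum_product)
    also have "\<dots> = (\<Sum>p\<in>?S. \<Sum>z\<in>tuples k. \<Sum>q\<in>?S. cnj (f z p) * f z q)" by (rule sum.swap)
    also have "\<dots> = (\<Sum>p\<in>?S. \<Sum>q\<in>?S. \<Sum>z\<in>tuples k. cnj (f z p) * f z q)"
      by (intro sum.cong refl sum.swap)
    also have "\<dots> = (\<Sum>i<n. \<Sum>x\<in>tuples k. \<Sum>j<n. \<Sum>y\<in>tuples k.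
        cnj (v i x) * mmult k (mctrans (C i)) (C j) x y * v j y)"
      by (simp add: sum.cartesian_product' f_def mmult_def mctrans_def
          sum_distrib_left sum_distrib_right mult_ac)
    also have "\<dots> = ?l" by (intro sum.cong refl sum.swap)
    finally show ?thesis by simp
  qed
  then show ?thesis by (simp add: block_psd_def Let_def cip_self sum_nonneg)
qed

section \<open>Linear maps and their adjoints\<close>

lemma lin_on_sum:
  assumes lin: "lin_on k \<Phi>" and "finite A" "\<And>p. p \<in> A \<Longrightarrow> g p \<in> tspace k"
  shows "\<Phi> (\<lambda>x y. \<Sum>p\<in>A. c p * g p x y) = (\<lambda>x y. \<Sum>p\<in>A. c p * \<Phi> (g p) x y)
    \<and> (\<lambda>x y. \<Sum>p\<in>A. c p * g p x y) \<in> tspace k"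
  using assms(2,3)
proof (induction A rule: finite_induct)
  case empty
  have "\<Phi> (msmult 0 mzero) = msmult 0 (\<Phi> mzero)"
    using lin tspace_mzero unfolding lin_on_def by blast
  then show ?case by (simp add: msmult_def mzero_def tspace_def)
next
  case (insert p A)
  let ?s = "\<lambda>x y. \<Sum>p\<in>A. c p * g p x y"
  have IH: "\<Phi> ?s = (\<lambda>x y. \<Sum>p\<in>A. c p * \<Phi> (g p) x y)" "?s \<in> tspace k" using insert by auto
  have g: "g p \<in> tspace k" using insert by simp
  have e: "(\<lambda>x y. \<Sum>p\<in>insert p A. c p * g p x y) = madd (msmult (c p) (g p)) ?s"
    using insert by (simp add: madd_def msmult_def)
  have "\<Phi> (madd (msmult (c p) (g p)) ?s) = madd (msmult (c p) (\<Phi> (g p))) (\<Phi> ?s)"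
    using lin[unfolded lin_on_def, rule_format, OF tspace_msmult[OF g] IH(2)]
      lin[unfolded lin_on_def, rule_format, OF g g] by simp
  also have "\<dots> = (\<lambda>x y. \<Sum>p\<in>insert p A. c p * \<Phi> (g p) x y)"
    using insert by (simp add: madd_def msmult_def IH(1))
  finally show ?case unfolding e using IH(2) g by (auto intro!: tspace_intros)
qed

text \<open>The entries of \<open>adjoint\<close> are pairings with images of matrix units;
  expanding \<open>X\<close> in matrix units extends these to all of \<open>tspace k\<close> by
  linearity.\<close>

lemma tinner_adjoint:
  fixes \<Phi> :: "'a::finite tmat \<Rightarrow> 'b::finite tmat"
  assumes lin: "lin_on k \<Phi>" and X: "X \<in> tspace k"
  shows "tinner k (\<Phi> X) Y = tinner k X (adjoint k \<Phi> Y)"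
proof -
  let ?S = "tuples k \<times> tuples k :: ('a list \<times> 'a list) set"
  let ?T = "tuples k \<times> tuples k :: ('b list \<times> 'b list) set"
  define c where "c = (\<lambda>p. X (fst p) (snd p))"
  define g :: "'a list \<times> 'a list \<Rightarrow> 'a tmat" where "g = (\<lambda>p. munit (fst p) (snd p))"
  have g: "g p \<in> tspace k" if "p \<in> ?S" for p
    using that by (auto simp: g_def intro: tspace_munit)
  have sum: "\<Phi> (\<lambda>x y. \<Sum>p\<in>?S. c p * g p x y) = (\<lambda>x y. \<Sum>p\<in>?S. c p * \<Phi> (g p) x y)"
    "(\<lambda>x y. \<Sum>p\<in>?S. c p * g p x y) \<in> tspace k"
    using lin_on_sum[OF lin, of ?S g c] g by auto
  have "X = (\<lambda>x y. \<Sum>p\<in>?S. c p * g p x y)"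
  proof (rule tspace_eqI[OF X sum(2)])
    fix x y :: "'a list" assume xy: "x \<in> tuples k" "y \<in> tuples k"
    have "(\<Sum>p\<in>?S. c p * g p x y) = (\<Sum>p\<in>?S. if p = (x, y) then X x y else 0)"
      by (intro sum.cong) (auto simp: c_def g_def munit_def)
    then show "X x y = (\<Sum>p\<in>?S. c p * g p x y)" using xy by simp
  qed
  then have "\<Phi> X = (\<lambda>x y. \<Sum>p\<in>?S. c p * \<Phi> (g p) x y)" using sum(1) by simp
  then have "tinner k (\<Phi> X) Y = (\<Sum>q\<in>?T. \<Sum>p\<in>?S. cnj (c p) * (cnj (\<Phi> (g p) (fst q) (snd q)) * Y (fst q) (snd q)))"
    by (simp add: tinner_cip cip_def case_prod_beta sum_distrib_right mult.assoc)
  also have "\<dots> = (\<Sum>p\<in>?S. \<Sum>q\<in>?T. cnj (c p) * (cnj (\<Phi> (g p) (fst q) (snd q)) * Y (fst q) (snd q)))"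
    by (rule sum.swap)
  also have "\<dots> = (\<Sum>p\<in>?S. cnj (c p) * tinner k (\<Phi> (g p)) Y)"
    by (simp add: tinner_cip cip_def case_prod_beta sum_distrib_left)
  also have "\<dots> = tinner k X (adjoint k \<Phi> Y)"
    unfolding tinner_cip[of k X] cip_def
    by (intro sum.cong) (auto simp: c_def g_def adjoint_def tuples_def)
  finally show ?thesis .
qed

section \<open>Unital trace-preserving completely positive maps\<close>

text \<open>The setting of the Schwarz inequality. For a quantum isomorphism map, trace preservation
  comes from the condition that \<open>adjoint k \<Phi>\<close> fixes the identity.\<close>

locale unital_trace_cp =
  fixes k :: nat and \<Phi> :: "'a::finite tmat \<Rightarrow> 'b::finite tmat"
  assumes maps: "X \<in> tspace k \<Longrightarrow> \<Phi> X \<in> tspace k"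
    and cp: "completely_positive k \<Phi>"
    and unital: "\<Phi> (mI k) = mI k"
    and trace: "X \<in> tspace k \<Longrightarrow> mtrace k (\<Phi> X) = mtrace k X"
begin

lemma gram_image_psd:
  assumes "\<And>i. C i \<in> tspace k"
  shows "block_psd k n (\<lambda>i j. \<Phi> (mmult k (mctrans (C i)) (C j)))"
proof -
  have "mmult k (mctrans (C i)) (C j) \<in> tspace k" for i j using assms by (intro tspace_intros)
  then show ?thesis
    using cp[unfolded completely_positive_def, rule_format, of "\<lambda>i j. mmult k (mctrans (C i)) (C j)" n]
      block_psd_gram[of k n C] by simp
qed

text \<open>The Gram block matrix of \<open>mI k\<close> and \<open>X\<close> has \<open>X\<close>
  and \<open>mctrans X\<close> off the diagonal; its image is positive, hence hermitian.\<close>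

lemma map_mctrans:
  assumes X: "X \<in> tspace k"
  shows "\<Phi> (mctrans X) = mctrans (\<Phi> X)"
proof (rule tspace_eqI)
  define C where "C = (\<lambda>i::nat. if i = 0 then mI k else X)"
  have "C i \<in> tspace k" for i using X by (auto simp: C_def intro: tspace_intros)
  from gram_image_psd[of C 2, OF this]
  have psd: "psd_on ({..<2} \<times> tuples k) (\<lambda>(i, x) (j, y). \<Phi> (mmult k (mctrans (C i)) (C j)) x y)"
    by (simp add: block_psd_iff)
  fix x y :: "'b list" assume "x \<in> tuples k" "y \<in> tuples k"
  then show "\<Phi> (mctrans X) x y = mctrans (\<Phi> X) x y"
    using psd_on_hermitian[OF _ psd, of "(0, y)" "(1, x)"] X
    by (simp add: C_def mmult_mI_left mmult_mI_right tspace_intros mctrans_def[of "\<Phi> X"])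
qed (use X in \<open>auto intro!: tspace_intros maps\<close>)

text \<open>The Schwarz inequality for blocks: complete the square in the block matrix of
  \<open>1, X\<^sub>0, X\<^sub>1, \<dots>\<close> by putting minus the sum of the \<open>\<Phi>(X\<^sub>j) v\<^sub>j\<close> into the slot of \<open>1\<close>.\<close>
lemma schwarz_defect_psd:
  assumes X: "\<And>i. X i \<in> tspace k"
  shows "block_psd k n (\<lambda>i j x y. \<Phi> (mmult k (mctrans (X i)) (X j)) x y
    - mmult k (mctrans (\<Phi> (X i))) (\<Phi> (X j)) x y)"
  unfolding block_psd_def Let_def
proof
  fix v :: "nat \<Rightarrow> 'b list \<Rightarrow> complex"
  define b where "b = (\<lambda>(M :: 'b tmat) p q. \<Sum>x\<in>tuples k. \<Sum>y\<in>tuples k. cnj (p x) * M x y * q y)"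
  define Y where "Y = (\<lambda>i. \<Phi> (X i))"
  have YT: "Y i \<in> tspace k" for i using X maps by (simp add: Y_def)
  define u where "u = (\<lambda>x. \<Sum>j<n. \<Sum>y\<in>tuples k. Y j x y * v j y)"
  \<comment> \<open>Slot 0 holds the identity, so \<open>X i\<close> and \<open>v i\<close> move to
    slot \<open>Suc i\<close>.\<close>
  define C where "C = (\<lambda>i. case i of 0 \<Rightarrow> mI k | Suc i \<Rightarrow> X i)"
  define w where "w = (\<lambda>i. case i of 0 \<Rightarrow> (\<lambda>x. - u x) | Suc i \<Rightarrow> v i)"
  have CT: "C i \<in> tspace k" for i using X by (auto simp: C_def intro: tspace_intros split: nat.split)
  define q where "q = (\<Sum>i<Suc n. \<Sum>j<Suc n. b (\<Phi> (mmult k (mctrans (C i)) (C j))) (w i) (w j))"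
  have q: "Im q = 0" "Re q \<ge> 0"
    using gram_image_psd[of C "Suc n", OF CT] unfolding block_psd_def Let_def q_def b_def by blast+
  define N where "N = cip (tuples k) u u"
  have b00: "b (mI k) (\<lambda>x. - u x) (\<lambda>x. - u x) = N"
  proof -
    have "b (mI k) (\<lambda>x. - u x) (\<lambda>x. - u x)
        = (\<Sum>x\<in>tuples k. \<Sum>y\<in>tuples k. if y = x then cnj (u x) * u x else 0)"
      unfolding b_def by (intro sum.cong) (auto simp: mI_def tuples_def)
    then show ?thesis by (simp add: N_def cip_def)
  qed
  have b01: "(\<Sum>j<n. b (Y j) (\<lambda>x. - u x) (v j)) = - N"
  proof -
    have "(\<Sum>j<n. b (Y j) (\<lambda>x. - u x) (v j)) = (\<Sum>x\<in>tuples k. \<Sum>j<n. \<Sum>y\<in>tuples k. - (cnj (u x) * (Y j x y * v j y)))"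
      unfolding b_def by (subst sum.swap) (simp add: mult.assoc)
    also have "\<dots> = - N" by (simp add: N_def cip_def u_def[of] sum_negf sum_distrib_left)
    finally show ?thesis .
  qed
  have swapb: "b (mctrans M) p r = cnj (b M r p)" for M p r
    unfolding b_def mctrans_def by (subst sum.swap) (simp add: algebra_simps)
  have b10: "(\<Sum>i<n. b (mctrans (Y i)) (v i) (\<lambda>x. - u x)) = - N"
    unfolding swapb cnj_sum[symmetric] b01 by (simp add: N_def cip_cnj)
  have bYY: "(\<Sum>i<n. \<Sum>j<n. b (mmult k (mctrans (Y i)) (Y j)) (v i) (v j)) = N"
  proof -
    have "(\<Sum>i<n. \<Sum>j<n. b (mmult k (mctrans (Y i)) (Y j)) (v i) (v j))
      = (\<Sum>i<n. \<Sum>j<n. \<Sum>z\<in>tuples k. cnj (\<Sum>x\<in>tuples k. Y i z x * v i x) * (\<Sum>y\<in>tuples k. Y j z y * v j y))"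
    proof (intro sum.cong refl)
      fix i j
      let ?g = "\<lambda>x y z. cnj (Y i z x * v i x) * (Y j z y * v j y)"
      have "b (mmult k (mctrans (Y i)) (Y j)) (v i) (v j) = (\<Sum>x\<in>tuples k. \<Sum>y\<in>tuples k. \<Sum>z\<in>tuples k. ?g x y z)"
        unfolding b_def mmult_def mctrans_def
        by (simp add: sum_distrib_left sum_distrib_right algebra_simps)
      also have "\<dots> = (\<Sum>x\<in>tuples k. \<Sum>z\<in>tuples k. \<Sum>y\<in>tuples k. ?g x y z)"
        by (intro sum.cong refl sum.swap)
      also have "\<dots> = (\<Sum>z\<in>tuples k. \<Sum>x\<in>tuples k. \<Sum>y\<in>tuples k. ?g x y z)" by (rule sum.swap)
      also have "\<dots> = (\<Sum>z\<in>tuples k. cnj (\<Sum>x\<in>tuples k. Y i z x * v i x) * (\<Sum>y\<in>tuples k. Y j z y * v j y))"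
        by (simp add: sum_product)
      finally show "b (mmult k (mctrans (Y i)) (Y j)) (v i) (v j) = \<dots>" .
    qed
    also have "\<dots> = (\<Sum>i<n. \<Sum>z\<in>tuples k. \<Sum>j<n. cnj (\<Sum>x\<in>tuples k. Y i z x * v i x) * (\<Sum>y\<in>tuples k. Y j z y * v j y))"
      by (intro sum.cong refl sum.swap)
    also have "\<dots> = (\<Sum>z\<in>tuples k. \<Sum>i<n. \<Sum>j<n. cnj (\<Sum>x\<in>tuples k. Y i z x * v i x) * (\<Sum>y\<in>tuples k. Y j z y * v j y))"
      by (rule sum.swap)
    also have "\<dots> = N"
      unfolding N_def cip_def u_def cnj_sum sum_product ..
    finally show ?thesis .
  qed
  \<comment> \<open>The blocks (0,0), (0,j) and (i,0) contribute \<open>N\<close>,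
    \<open>- N\<close> and \<open>- N\<close>; the resulting \<open>- N\<close> is, by
    \<open>bYY\<close>, minus the form of the blocks
    \<open>mmult k (mctrans (Y i)) (Y j)\<close>.\<close>
  have "q = b (mI k) (\<lambda>x. - u x) (\<lambda>x. - u x) + (\<Sum>j<n. b (Y j) (\<lambda>x. - u x) (v j))
      + (\<Sum>i<n. b (mctrans (Y i)) (v i) (\<lambda>x. - u x))
      + (\<Sum>i<n. \<Sum>j<n. b (\<Phi> (mmult k (mctrans (X i)) (X j))) (v i) (v j))"
    unfolding q_def sum.lessThan_Suc_shift
    by (simp add: C_def w_def sum.distrib X Y_def mmult_mI_left mmult_mI_right tspace_intros unital map_mctrans)
  then have "q = (\<Sum>i<n. \<Sum>j<n. b (\<Phi> (mmult k (mctrans (X i)) (X j))) (v i) (v j))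
      - (\<Sum>i<n. \<Sum>j<n. b (mmult k (mctrans (Y i)) (Y j)) (v i) (v j))"
    unfolding b00 b01 b10 bYY by simp
  also have "\<dots> = (\<Sum>i<n. \<Sum>j<n. \<Sum>x\<in>tuples k. \<Sum>y\<in>tuples k. cnj (v i x) *
      (\<Phi> (mmult k (mctrans (X i)) (X j)) x y - mmult k (mctrans (\<Phi> (X i))) (\<Phi> (X j)) x y) * v j y)"
    unfolding b_def Y_def sum_subtractf[symmetric] by (intro sum.cong refl) (simp add: algebra_simps)
  finally show "Im (\<Sum>i<n. \<Sum>j<n. \<Sum>x\<in>tuples k. \<Sum>y\<in>tuples k. cnj (v i x) *
      (\<Phi> (mmult k (mctrans (X i)) (X j)) x y - mmult k (mctrans (\<Phi> (X i))) (\<Phi> (X j)) x y) * v j y) = 0 \<and>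
    0 \<le> Re (\<Sum>i<n. \<Sum>j<n. \<Sum>x\<in>tuples k. \<Sum>y\<in>tuples k. cnj (v i x) *
      (\<Phi> (mmult k (mctrans (X i)) (X j)) x y - mmult k (mctrans (\<Phi> (X i))) (\<Phi> (X j)) x y) * v j y)"
    using q by simp
qed

text \<open>In the defect block matrix of \<open>X\<close> and \<open>Y\<close>, the norm condition
  and trace preservation make the diagonal of block (0,0) sum to zero. Being nonnegative, it
  vanishes entrywise, and a zero diagonal entry of a positive matrix kills its row, so block (0,1),
  the product defect, vanishes too.\<close>

lemma multiplicative_domain:
  assumes X: "X \<in> tspace k" and Y: "Y \<in> tspace k"
    and iso: "tinner k (\<Phi> X) (\<Phi> X) = tinner k X X"
  shows "\<Phi> (mmult k (mctrans X) Y) = mmult k (mctrans (\<Phi> X)) (\<Phi> Y)"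
proof (rule tspace_eqI)
  define C where "C = (\<lambda>i::nat. if i = 0 then X else Y)"
  have CT: "C i \<in> tspace k" for i using X Y by (simp add: C_def)
  define D where "D = (\<lambda>i j x y. \<Phi> (mmult k (mctrans (C i)) (C j)) x y
    - mmult k (mctrans (\<Phi> (C i))) (\<Phi> (C j)) x y)"
  have psd: "psd_on ({..<2} \<times> tuples k) (\<lambda>(i, x) (j, y). D i j x y)"
    using schwarz_defect_psd[of C 2, OF CT] by (simp add: block_psd_iff D_def)
  have diag: "Im (D 0 0 x x) = 0 \<and> Re (D 0 0 x x) \<ge> 0" if "x \<in> tuples k" for x
    using psd_on_diag[OF _ psd, of "(0, x)"] that by simp
  have "(\<Sum>x\<in>tuples k. D 0 0 x x) = mtrace k (\<Phi> (mmult k (mctrans X) X)) - tinner k (\<Phi> X) (\<Phi> X)"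
    by (simp add: D_def C_def mtrace_def tinner_def sum_subtractf)
  also have "\<dots> = 0" using X iso by (simp add: trace tspace_intros tinner_def)
  finally have "(\<Sum>x\<in>tuples k. Re (D 0 0 x x)) = 0" by (metis Re_sum zero_complex.simps(1))
  then have "\<forall>x\<in>tuples k. Re (D 0 0 x x) = 0"
    using diag by (subst (asm) sum_nonneg_eq_0_iff) auto
  then have D0: "D 0 0 x x = 0" if "x \<in> tuples k" for x using diag that by (simp add: complex_eq_iff)
  fix x y :: "'b list" assume xy: "x \<in> tuples k" "y \<in> tuples k"
  then have "D 0 1 x y = 0"
    using psd_on_zero_diag[OF _ psd, of "(0, x)" "(1, y)"] D0 by simp
  then show "\<Phi> (mmult k (mctrans X) Y) x y = mmult k (mctrans (\<Phi> X)) (\<Phi> Y) x y"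
    by (simp add: D_def C_def)
qed (use X Y in \<open>auto intro!: tspace_intros maps\<close>)

text \<open>The trace of the product rule: equality of norms at \<open>X\<close> already forces
  equality of all pairings with \<open>X\<close>.\<close>

lemma isometric_imp_tinner:
  assumes "X \<in> tspace k" "Y \<in> tspace k" "tinner k (\<Phi> X) (\<Phi> X) = tinner k X X"
  shows "tinner k (\<Phi> X) (\<Phi> Y) = tinner k X Y"
  using multiplicative_domain[OF assms] trace[of "mmult k (mctrans X) Y"] assms
  by (simp add: tinner_def tspace_intros)

end

section \<open>Rotations and homomorphism tensors\<close>

text \<open>\<open>rot\<close> moves each entry of \<open>cyc_seq\<close> to the cyclically next
  one. Every entry has a predecessor, and a finite set mapped onto itself is mapped
  bijectively.\<close>

lemma rot_permutes: "rot k permutes {0..<2*k}"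
proof (rule bij_imp_permutes)
  let ?s = "cyc_seq k" and ?n = "2 * k" and ?I = "{0..<2*k}"
  have s: "distinct ?s" "length ?s = ?n" "set ?s = ?I"
    by (auto simp: cyc_seq_def)
  have step: "rot k (?s ! i) = ?s ! ((i + 1) mod ?n)" if i: "i < ?n" for i
  proof -
    have "?s ! i < ?n" using nth_mem[of i ?s] s i by auto
    moreover have "(THE l. l < ?n \<and> ?s ! l = ?s ! i) = i"
      using i s by (intro the_equality) (auto simp: nth_eq_iff_index_eq)
    ultimately show ?thesis by (simp add: rot_def)
  qed
  have sub: "?I \<subseteq> rot k ` ?I"
  proof
    fix q assume "q \<in> ?I"
    then obtain j where j: "j < ?n" "q = ?s ! j" using s by (metis in_set_conv_nth)
    define i where "i = (if j = 0 then ?n - 1 else j - 1)"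
    have i: "i < ?n" "(i + 1) mod ?n = j" using j(1) by (auto simp: i_def)
    then have "q = rot k (?s ! i)" using step[OF i(1)] j(2) by simp
    moreover have "?s ! i \<in> ?I" using nth_mem[of i ?s] s i(1) by auto
    ultimately show "q \<in> rot k ` ?I" by blast
  qed
  then have inj: "inj_on (rot k) ?I" by (intro finite_surj_inj) auto
  have "card (rot k ` ?I) = card ?I" using inj by (rule card_image)
  with sub have "rot k ` ?I = ?I" by (intro card_subset_eq[symmetric]) auto
  with inj show "bij_betw (rot k) ?I ?I" by (simp add: bij_betw_def)
qed (simp add: rot_def)

lemma cyc_group_permutes: "\<sigma> \<in> cyc_group k \<Longrightarrow> \<sigma> permutes {0..<2*k}"
  unfolding cyc_group_def using permutes_funpow[OF rot_permutes] by auto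

text \<open>\<open>cyc_group\<close> is given by nonnegative powers only. As \<open>rot\<close> has
  finite order, an exponent \<open>n > j\<close> with \<open>rot k ^^ n = id\<close> yields the
  inverse of the \<open>j\<close>-th power as the power \<open>n - j\<close>.\<close>

lemma cyc_group_inverse:
  assumes "\<sigma> \<in> cyc_group k"
  obtains \<tau> where "\<tau> \<in> cyc_group k" "\<tau> \<circ> \<sigma> = id"
proof -
  obtain j where j: "\<sigma> = rot k ^^ j" using assms by (auto simp: cyc_group_def)
  have "permutation (rot k)" using rot_permutes permutation_permutes by blast
  then obtain n where n: "rot k ^^ n = id" "n > j" by (rule permutation_is_nilpotent')
  have "rot k ^^ (n - j) \<circ> \<sigma> = id"
    using n unfolding j funpow_add[symmetric] by simp
  then show thesis by (rule that[rotated]) (auto simp: cyc_group_def)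
qed

section \<open>Permutation of tensor positions\<close>

definition permute_positions :: "nat \<Rightarrow> (nat \<Rightarrow> nat) \<Rightarrow> 'a list \<Rightarrow> 'a list" where
  "permute_positions n \<sigma> z = map (\<lambda>j. z ! inv_into {0..<n} \<sigma> j) [0..<n]"

lemma pact_permute_positions:
  "x \<in> tuples k \<Longrightarrow> y \<in> tuples k \<Longrightarrow>
    pact k \<sigma> X x y = X (take k (permute_positions (2*k) \<sigma> (x @ y))) (drop k (permute_positions (2*k) \<sigma> (x @ y)))"
  by (simp add: pact_def permute_positions_def Let_def tuples_def)

lemma length_permute_positions [simp]: "length (permute_positions n \<sigma> z) = n"
  by (simp add: permute_positions_def)

lemma permute_positions_nth:
  assumes "\<sigma> permutes {0..<n}" "i < n"
  shows "permute_positions n \<sigma> z ! \<sigma> i = z ! i"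
proof -
  have "\<sigma> i < n" using assms permutes_in_image[OF assms(1), of i] by simp
  moreover have "inv_into {0..<n} \<sigma> (\<sigma> i) = i"
    using assms by (intro inv_into_f_f) (auto simp: permutes_inj_on)
  ultimately show ?thesis by (simp add: permute_positions_def)
qed

lemma bij_betw_permute_positions:
  assumes "\<sigma> permutes {0..<n}"
  shows "bij_betw (permute_positions n \<sigma>) (tuples n) (tuples n :: 'a::finite list set)"
proof -
  have "inj_on (permute_positions n \<sigma>) (tuples n :: 'a list set)"
  proof (rule inj_onI)
    fix z z' :: "'a list"
    assume z: "z \<in> tuples n" "z' \<in> tuples n" "permute_positions n \<sigma> z = permute_positions n \<sigma> z'"
    show "z = z'"
    proof (rule nth_equalityI)
      show "length z = length z'" using z by (simp add: tuples_def)
      fix i assume "i < length z"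
      then have "i < n" using z by (simp add: tuples_def)
      then show "z ! i = z' ! i" using permute_positions_nth[OF assms] z(3) by metis
    qed
  qed
  moreover have "permute_positions n \<sigma> ` tuples n \<subseteq> (tuples n :: 'a list set)"
    by (auto simp: tuples_def)
  ultimately show ?thesis unfolding bij_betw_def by (simp add: endo_inj_surj)
qed

text \<open>Concatenation turns pairs of \<open>k\<close>-tuples into \<open>2*k\<close>-tuples, on
  which position permutations act; invariance of the inner product then becomes a reindexing of one
  sum.\<close>

lemma tinner_append:
  "tinner k A B = (\<Sum>z\<in>tuples (2*k). cnj (A (take k z) (drop k z)) * B (take k z) (drop k z))"
  unfolding tinner_cip cip_def
  by (rule sum.reindex_bij_witness[where j = "\<lambda>(x, y). x @ y" and i = "\<lambda>z. (take k z, drop k z)"])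
    (auto simp: tuples_def)

lemma tinner_pact:
  fixes A B :: "'a::finite tmat"
  assumes "\<sigma> permutes {0..<2*k}"
  shows "tinner k (pact k \<sigma> A) (pact k \<sigma> B) = tinner k A B"
proof -
  let ?p = "permute_positions (2*k) \<sigma>"
  let ?f = "\<lambda>z. cnj (A (take k z) (drop k z)) * B (take k z) (drop k z)"
  have "tinner k (pact k \<sigma> A) (pact k \<sigma> B) = (\<Sum>z\<in>tuples (2*k). ?f (?p z))"
    unfolding tinner_append
  proof (intro sum.cong refl)
    fix z :: "'a list" assume "z \<in> tuples (2*k)"
    then have "take k z \<in> tuples k" "drop k z \<in> tuples k" by (auto simp: tuples_def)
    then show "cnj (pact k \<sigma> A (take k z) (drop k z)) * pact k \<sigma> B (take k z) (drop k z) = ?f (?p z)"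
      by (simp add: pact_permute_positions)
  qed
  also have "\<dots> = (\<Sum>z\<in>tuples (2*k). ?f z)"
    by (rule sum.reindex_bij_betw[OF bij_betw_permute_positions[OF assms]])
  finally show ?thesis by (simp add: tinner_append)
qed

text \<open>Evaluating \<open>pact k \<sigma> (pact k \<tau> X)\<close> moves the tuple entry at
  position \<open>i\<close> first to \<open>\<sigma> i\<close> and then to
  \<open>\<tau> (\<sigma> i)\<close>, which is \<open>i\<close>.\<close>

lemma pact_inverse:
  fixes X :: "'a::finite tmat"
  assumes \<sigma>: "\<sigma> permutes {0..<2*k}" and \<tau>: "\<tau> permutes {0..<2*k}" and inv: "\<tau> \<circ> \<sigma> = id"
    and X: "X \<in> tspace k"
  shows "pact k \<sigma> (pact k \<tau> X) = X"
proof (rule tspace_eqI[OF tspace_pact X])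
  fix x y :: "'a list" assume xy: "x \<in> tuples k" "y \<in> tuples k"
  let ?w = "permute_positions (2*k) \<sigma> (x @ y)"
  have "permute_positions (2*k) \<tau> ?w = x @ y"
  proof (rule nth_equalityI)
    show "length (permute_positions (2*k) \<tau> ?w) = length (x @ y)" using xy by (simp add: tuples_def)
    fix i assume "i < length (permute_positions (2*k) \<tau> ?w)"
    then have i: "i < 2*k" by simp
    have si: "\<sigma> i < 2*k" using i permutes_in_image[OF \<sigma>, of i] by simp
    have "permute_positions (2*k) \<tau> ?w ! \<tau> (\<sigma> i) = (x @ y) ! i"
      using permute_positions_nth[OF \<tau> si] permute_positions_nth[OF \<sigma> i] by metis
    then show "permute_positions (2*k) \<tau> ?w ! i = (x @ y) ! i"
      using inv by (metis comp_apply id_apply)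
  qed
  moreover have "take k ?w \<in> tuples k" "drop k ?w \<in> tuples k" by (auto simp: tuples_def)
  ultimately show "pact k \<sigma> (pact k \<tau> X) x y = X x y"
    using xy by (simp add: pact_permute_positions) (simp add: tuples_def)
qed

section \<open>Homomorphism tensors of bilabelled minors\<close>

lemma bminors_all_labelled:
  assumes "F \<in> bminors F0" "bV F0 \<subseteq> set (bin F0) \<union> set (bout F0)"
  shows "bV F \<subseteq> set (bin F) \<union> set (bout F) \<and> length (bin F) = length (bin F0)
    \<and> length (bout F) = length (bout F0)"
  using assms by (induction rule: bminors.induct) auto

lemma Qk_all_labelled:
  assumes "F \<in> Qk k"
  shows "bV F \<subseteq> set (bin F) \<union> set (bout F)" "length (bin F) = k" "length (bout F) = k"
proof -
  have C: "bV (Cgraph k) \<subseteq> set (bin (Cgraph k)) \<union> set (bout (Cgraph k))"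
    "length (bin (Cgraph k)) = k" "length (bout (Cgraph k)) = k"
    by (auto simp: Cgraph_def)
  have M: "bV (Mgraph k) \<subseteq> set (bin (Mgraph k)) \<union> set (bout (Mgraph k))"
    "length (bin (Mgraph k)) = k" "length (bout (Mgraph k)) = k"
    by (auto simp: Mgraph_def)
  have "bV F \<subseteq> set (bin F) \<union> set (bout F) \<and> length (bin F) = k \<and> length (bout F) = k"
    using assms bminors_all_labelled[OF _ C(1)] bminors_all_labelled[OF _ M(1)] C(2,3) M(2,3)
    unfolding Qk_def QP_def QS_def by (metis Un_iff)
  then show "bV F \<subseteq> set (bin F) \<union> set (bout F)" "length (bin F) = k" "length (bout F) = k" by auto
qed

lemma tspace_hom_tensor:
  assumes "F \<in> Qk k"
  shows "hom_tensor G F \<in> tspace k"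
proof -
  have "{h \<in> extensional (bV F). (\<forall>e\<in>bE F. \<forall>a\<in>e. \<forall>b\<in>e. a \<noteq> b \<longrightarrow> G (h a) (h b))
        \<and> map h (bin F) = x \<and> map h (bout F) = y} = {}" if "\<not> (length x = k \<and> length y = k)" for x y
    using that Qk_all_labelled(2,3)[OF assms] by auto
  then have "hom_tensor G F x y = 0" if "\<not> (length x = k \<and> length y = k)" for x y
    using that unfolding hom_tensor_def by (simp only: card.empty of_nat_0 simp_thms)
  then show ?thesis unfolding tspace_def by blast
qed

text \<open>Every vertex of a minor carries a label, because only unlabelled vertices are deleted
  and contraction passes labels on. Prescribed label values thus admit at most one homomorphism, so
  all entries are 0 or 1.\<close>

lemma hom_tensor_idem:
  assumes "F \<in> Qk k"
  shows "hom_tensor G F x y * hom_tensor G F x y = hom_tensor G F x y"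
proof -
  define A where "A = {h \<in> extensional (bV F). (\<forall>e\<in>bE F. \<forall>a\<in>e. \<forall>b\<in>e. a \<noteq> b \<longrightarrow> G (h a) (h b))
        \<and> map h (bin F) = x \<and> map h (bout F) = y}"
  have "h = h'" if "h \<in> A" "h' \<in> A" for h h'
  proof (rule extensionalityI[of _ "bV F"])
    show "h \<in> extensional (bV F)" "h' \<in> extensional (bV F)" using that by (auto simp: A_def)
    fix v assume "v \<in> bV F"
    then have "v \<in> set (bin F) \<or> v \<in> set (bout F)" using Qk_all_labelled(1)[OF assms] by auto
    moreover have "map h (bin F) = map h' (bin F)" "map h (bout F) = map h' (bout F)"
      using that by (auto simp: A_def)
    ultimately show "h v = h' v" by auto
  qed
  then have "A = {} \<or> (\<exists>h. A = {h})" by blast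
  then have "card A = 0 \<or> card A = 1" by auto
  then show ?thesis unfolding hom_tensor_def A_def[symmetric] by auto
qed

lemma cnj_hom_tensor: "cnj (hom_tensor G F x y) = hom_tensor G F x y"
  by (simp add: hom_tensor_def)

text \<open>For entries 0 and 1 the squared norm is the sum of the entries, a pairing with
  \<open>mJ k\<close>; this is how the condition on \<open>adjoint k \<Phi> (mJ k)\<close> gives
  norm preservation.\<close>

lemma tinner_mJ_hom_tensor:
  fixes G :: "'a \<Rightarrow> 'a \<Rightarrow> bool"
  assumes "F \<in> Qk k"
  shows "tinner k (hom_tensor G F) (hom_tensor G F) = tinner k (mJ k) (hom_tensor G F)"
  unfolding tinner_cip cip_def
proof (intro sum.cong refl)
  fix p :: "'a list \<times> 'a list" assume p: "p \<in> tuples k \<times> tuples k"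
  obtain x y where xy: "p = (x, y)" by fastforce
  have "mJ k x y = 1" using p by (simp add: xy mJ_def tuples_def)
  then show "cnj (case p of (x, y) \<Rightarrow> hom_tensor G F x y) * (case p of (x, y) \<Rightarrow> hom_tensor G F x y)
      = cnj (case p of (x, y) \<Rightarrow> mJ k x y) * (case p of (x, y) \<Rightarrow> hom_tensor G F x y)"
    by (simp only: xy prod.case cnj_hom_tensor hom_tensor_idem[OF assms] complex_cnj_one mult_1)
qed

lemma qalg_tspace: "A \<in> qalg k G \<Longrightarrow> A \<in> tspace k"
  by (induction rule: qalg.induct) (auto intro: tspace_intros tspace_hom_tensor)

lemma mtrace_mI: "mtrace k (mI k :: 'a::finite tmat) = of_nat (CARD('a) ^ k)"
proof -
  have "mtrace k (mI k :: 'a tmat) = (\<Sum>x\<in>(tuples k :: 'a list set). 1)"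
    unfolding mtrace_def by (intro sum.cong) (auto simp: mI_def tuples_def)
  then show ?thesis by (simp add: card_tuples)
qed

lemma tinner_mJ_mJ: "tinner k (mJ k) (mJ k :: 'a::finite tmat) = of_nat ((CARD('a) ^ k) ^ 2)"
proof -
  have "tinner k (mJ k) (mJ k :: 'a tmat) = (\<Sum>x\<in>(tuples k \<times> tuples k :: ('a list \<times> 'a list) set). 1)"
    unfolding tinner_cip cip_def by (intro sum.cong) (auto simp: mJ_def tuples_def)
  then show ?thesis by (simp add: card_tuples power2_eq_square)
qed

section \<open>Quantum isomorphism maps and algebraic equivalence\<close>

lemma level_qi_map_imp_alg_equiv:
  fixes G :: "'a::finite \<Rightarrow> 'a \<Rightarrow> bool" and H :: "'b::finite \<Rightarrow> 'b \<Rightarrow> bool"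
  assumes card: "CARD('a) = CARD('b)" and qi: "level_qi_map k G H \<Phi>"
  shows "alg_equiv k G H"
proof -
  have maps: "\<Phi> X \<in> tspace k" if "X \<in> tspace k" for X
    using qi that unfolding level_qi_map_def by blast
  have lin: "lin_on k \<Phi>" and cp: "completely_positive k \<Phi>"
    and map_I: "\<Phi> (mI k) = mI k" "adjoint k \<Phi> (mI k) = mI k"
    and map_J: "\<Phi> (mJ k) = mJ k" "adjoint k \<Phi> (mJ k) = mJ k"
    and map_had: "\<And>F X. F \<in> QP k \<Longrightarrow> X \<in> tspace k \<Longrightarrow> \<Phi> (mhad (hom_tensor G F) X) = mhad (hom_tensor H F) (\<Phi> X)"
    and map_hom: "\<And>F. F \<in> Qk k \<Longrightarrow> \<Phi> (hom_tensor G F) = hom_tensor H F"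
    and map_perm: "\<And>\<sigma> X. \<sigma> \<in> cyc_group k \<Longrightarrow> X \<in> tspace k \<Longrightarrow> \<Phi> (pact k \<sigma> X) = pact k \<sigma> (\<Phi> X)"
    using qi unfolding level_qi_map_def by auto
  have map_add: "\<Phi> (madd X Y) = madd (\<Phi> X) (\<Phi> Y)" if "X \<in> tspace k" "Y \<in> tspace k" for X Y
    using lin that unfolding lin_on_def by blast
  have map_smult: "\<Phi> (msmult c X) = msmult c (\<Phi> X)" if "X \<in> tspace k" for X c
    using lin that unfolding lin_on_def by blast
  have map_zero: "\<Phi> mzero = mzero"
    using map_smult[OF tspace_mzero, of 0] by (simp add: msmult_def mzero_def)
  have flip: "tinner k Y (\<Phi> X) = cnj (tinner k X (adjoint k \<Phi> Y))" if "X \<in> tspace k" for X Y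
    using tinner_adjoint[OF lin that] by (metis tinner_cnj)
  have trace: "mtrace k (\<Phi> X) = mtrace k X" if "X \<in> tspace k" for X
    using flip[OF that, of "mI k"] by (simp add: map_I tinner_cnj tinner_mI)
  interpret unital_trace_cp k \<Phi>
    by unfold_locales (simp_all add: maps cp map_I trace)
  \<comment> \<open>Preservation of all pairings with \<open>X\<close> visibly passes to linear
    combinations, which preservation of the norm does not; by \<open>isometric_imp_tinner\<close>
    both single out the same matrices, so either may be used to show membership.\<close>
  define S where "S = {X \<in> tspace k. \<forall>Y\<in>tspace k. tinner k (\<Phi> X) (\<Phi> Y) = tinner k X Y}"
  have ST: "X \<in> tspace k" if "X \<in> S" for X using that by (simp add: S_def)
  have SI: "X \<in> S" if "X \<in> tspace k" "tinner k (\<Phi> X) (\<Phi> X) = tinner k X X" for X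
    using isometric_imp_tinner that by (simp add: S_def)
  have SD: "tinner k (\<Phi> X) (\<Phi> Y) = tinner k X Y" if "X \<in> S" "Y \<in> tspace k" for X Y
    using that by (simp add: S_def)
  have S_ctrans: "mctrans X \<in> S" if "X \<in> S" for X
    using that ST[OF that] SD[OF that ST[OF that]]
    by (intro SI tspace_intros) (simp_all add: map_mctrans tinner_mctrans)
  \<comment> \<open>The product rule has an adjoint on the left; applied to
    \<open>mctrans X\<close>, again in \<open>S\<close>, it gives plain products.\<close>
  have S_mult: "\<Phi> (mmult k X Y) = mmult k (\<Phi> X) (\<Phi> Y)" if "X \<in> S" "Y \<in> tspace k" for X Y
    using multiplicative_domain[of "mctrans X" Y] SD[OF S_ctrans[OF that(1)] ST[OF S_ctrans[OF that(1)]]]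
      ST[OF that(1)] that(2) by (simp add: map_mctrans tspace_intros)
  have qS: "A \<in> S" if "A \<in> qalg k G" for A
    using that
  proof (induction rule: qalg.induct)
    \<comment> \<open>The squared norms of \<open>mI k\<close> and \<open>mJ k\<close> count tuples
      and pairs of tuples; here the equality of the vertex numbers enters.\<close>
    case I then show ?case
      using card by (intro SI tspace_intros) (simp add: map_I tinner_mI mtrace_mI)
  next
    case J then show ?case
      using card by (intro SI tspace_intros) (simp add: map_J tinner_mJ_mJ)
  next
    case (hom F)
    then have T: "hom_tensor G F \<in> tspace k" by (rule tspace_hom_tensor)
    \<comment> \<open>Since the adjoint fixes \<open>mJ k\<close>, entry sums are preserved, and
      these are the squared norms of homomorphism tensors.\<close>
    have "tinner k (mJ k) (hom_tensor H F) = tinner k (mJ k) (hom_tensor G F)"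
      using flip[OF T, of "mJ k"] hom map_hom
      by (simp add: map_J tinner_cnj)
    then show ?case
      using hom map_hom
      by (intro SI T) (simp add: tinner_mJ_hom_tensor)
  next
    case zero
    then show ?case by (intro SI tspace_intros) (simp add: map_zero, simp add: tinner_cip cip_def mzero_def)
  next
    case (add A B)
    then show ?case
      using map_add
      by (simp add: S_def tspace_intros tinner_madd_left)
  next
    case (smult A c)
    then show ?case
      using map_smult
      by (auto simp: S_def tspace_intros tinner_msmult_left)
  next
    case (mult A B)
    have "tinner k (\<Phi> (mmult k A B)) (\<Phi> Y) = tinner k (mmult k A B) Y" if Y: "Y \<in> tspace k" for Y
    proof -
      \<comment> \<open>The factor \<open>A\<close> crosses the inner product as its adjoint, which
        also lies in \<open>S\<close> and is absorbed into the argument of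
        \<open>\<Phi>\<close>.\<close>
      have "tinner k (\<Phi> (mmult k A B)) (\<Phi> Y) = tinner k (\<Phi> B) (mmult k (\<Phi> (mctrans A)) (\<Phi> Y))"
        using mult ST by (simp add: S_mult tinner_mmult_left map_mctrans)
      also have "\<dots> = tinner k (\<Phi> B) (\<Phi> (mmult k (mctrans A) Y))"
        using mult Y by (simp add: S_mult S_ctrans)
      also have "\<dots> = tinner k B (mmult k (mctrans A) Y)"
        using mult Y ST by (intro SD tspace_intros)
      finally show ?thesis by (simp add: tinner_mmult_left)
    qed
    then show ?case using ST[OF mult.IH(1)] ST[OF mult.IH(2)] unfolding S_def by (simp add: tspace_intros)
  next
    case (ctrans A)
    then show ?case by (intro S_ctrans)
  next
    case (had F A)
    have "tinner k (\<Phi> (mhad (hom_tensor G F) A)) (\<Phi> Y) = tinner k (mhad (hom_tensor G F) A) Y"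
      if Y: "Y \<in> tspace k" for Y
    proof -
      \<comment> \<open>Schur multiplication by a real tensor is self-adjoint and intertwined by
        \<open>\<Phi>\<close>, so it moves over to \<open>Y\<close> and back.\<close>
      have "tinner k (\<Phi> (mhad (hom_tensor G F) A)) (\<Phi> Y) = tinner k (\<Phi> A) (\<Phi> (mhad (hom_tensor G F) Y))"
        using had Y ST by (simp add: map_had tinner_mhad cnj_hom_tensor)
      also have "\<dots> = tinner k A (mhad (hom_tensor G F) Y)"
        using had Y by (intro SD tspace_intros)
      finally show ?thesis by (simp add: tinner_mhad cnj_hom_tensor)
    qed
    then show ?case using ST[OF had.IH] unfolding S_def by (simp add: tspace_intros)
  next
    case (perm \<sigma> A)
    show ?case
      using perm SD[of A A] ST cyc_group_permutes
      by (intro SI tspace_intros) (simp add: map_perm tinner_pact)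
  qed
  have inj: "inj_on \<Phi> (qalg k G)"
  proof (rule inj_onI)
    fix A B assume A: "A \<in> qalg k G" and B: "B \<in> qalg k G" and eq: "\<Phi> A = \<Phi> B"
    let ?D = "madd A (msmult (-1) B)"
    have AB: "A \<in> tspace k" "B \<in> tspace k" using A B qalg_tspace by auto
    have D: "?D \<in> qalg k G" using A B by (intro qalg.intros)
    \<comment> \<open>As pairings are preserved, \<open>?D\<close> has the norm of its image, which
      is zero.\<close>
    have "\<Phi> ?D = madd (\<Phi> A) (msmult (-1) (\<Phi> B))"
      using AB by (simp add: map_add map_smult tspace_intros)
    also have "\<dots> = mzero" by (simp add: eq madd_def msmult_def mzero_def)
    finally have "tinner k ?D ?D = 0"
      using SD[OF qS[OF D] qalg_tspace[OF D]] by (simp add: tinner_cip cip_def mzero_def)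
    then have "?D = mzero" using tinner_self_eq_0 qalg_tspace[OF D] by blast
    then show "A = B" by (simp add: madd_def msmult_def mzero_def fun_eq_iff)
  qed
  have img: "\<Phi> ` qalg k G = qalg k H"
  proof
    have "\<Phi> A \<in> qalg k H" if "A \<in> qalg k G" for A
      using that
      by (induction rule: qalg.induct) (auto simp: map_zero map_I map_J map_hom
        map_add map_smult map_had map_perm S_mult map_mctrans qS qalg_tspace intro: qalg.intros)
    then show "\<Phi> ` qalg k G \<subseteq> qalg k H" by blast
    \<comment> \<open>Surjectivity: each rule generating the algebra of \<open>H\<close> lifts to
      the same rule for \<open>G\<close>, since \<open>\<Phi>\<close> respects all of them.\<close>
    have "\<exists>A\<in>qalg k G. B = \<Phi> A" if "B \<in> qalg k H" for B
      using that
    proof (induction rule: qalg.induct)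
      case I then show ?case using map_I(1) qalg.I by metis
    next
      case J then show ?case using map_J(1) qalg.J by metis
    next
      case (hom F) then show ?case
        using map_hom qalg.hom by metis
    next
      case zero
      then show ?case using map_zero qalg.zero by metis
    next
      case (add A B) then show ?case
        using map_add
          qalg.add qalg_tspace by metis
    next
      case (smult A c) then show ?case
        using map_smult
          qalg.smult qalg_tspace by metis
    next
      case (mult A B) then show ?case using S_mult qS qalg.mult qalg_tspace by metis
    next
      case (ctrans A) then show ?case using map_mctrans qalg.ctrans qalg_tspace by metis
    next
      case (had F A) then show ?case
        using map_had
          qalg.had qalg_tspace by metis
    next
      case (perm \<sigma> A) then show ?case
        using map_perm
          qalg.perm qalg_tspace by metis
    qed
    then show "qalg k H \<subseteq> \<Phi> ` qalg k G" by blast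
  qed
  show ?thesis unfolding alg_equiv_def
    by (rule exI[of _ \<Phi>])
      (simp add: bij_betw_def inj img map_add map_smult map_mctrans S_mult qS qalg_tspace[of _ k G]
        map_had map_I map_J map_hom map_perm trace)
qed

section \<open>Orthogonal projection onto the algebra of a graph\<close>

lemma tinner_mmult_right: "tinner k A (mmult k X D) = tinner k (mmult k A (mctrans D)) X"
proof -
  have "tinner k A (mmult k X D) = mtrace k (mmult k (mmult k (mctrans A) X) D)"
    by (simp add: tinner_def mmult_assoc)
  also have "\<dots> = mtrace k (mmult k D (mmult k (mctrans A) X))" by (rule mtrace_mmult_commute)
  finally show ?thesis by (simp add: tinner_def mctrans_mmult mmult_assoc)
qed

lemma tinner_munit_left:
  fixes A :: "'a::finite tmat"
  assumes "x \<in> tuples k" "y \<in> tuples k"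
  shows "tinner k (munit x y) A = A x y"
proof -
  have "tinner k (munit x y) A = (\<Sum>p\<in>tuples k \<times> tuples k. if p = (x, y) then A x y else 0)"
    unfolding tinner_cip cip_def by (intro sum.cong) (auto simp: munit_def split: if_splits)
  then show ?thesis using assms by simp
qed

lemma qalg_sum:
  assumes "finite L" "\<And>l. l \<in> L \<Longrightarrow> M l \<in> qalg k G"
  shows "(\<lambda>x y. \<Sum>l\<in>L. M l x y) \<in> qalg k G"
  using assms
proof (induction L rule: finite_induct)
  case empty
  then show ?case using qalg.zero by (simp add: mzero_def)
next
  case (insert l L)
  then have "madd (M l) (\<lambda>x y. \<Sum>l\<in>L. M l x y) \<in> qalg k G" by (intro qalg.add) auto
  then show ?case using insert by (simp add: madd_def)
qed

lemma qalg_projection_exists: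
  fixes G :: "'a::finite \<Rightarrow> 'a \<Rightarrow> bool"
  shows "\<exists>Y\<in>qalg k G. \<forall>A\<in>qalg k G. tinner k A Y = tinner k A X"
proof -
  let ?S = "tuples k \<times> tuples k :: ('a list \<times> 'a list) set"
  have "\<exists>Y\<in>case_prod ` qalg k G. \<forall>A\<in>case_prod ` qalg k G. cip ?S A (\<lambda>p. case_prod X p - Y p) = 0"
  proof (rule orthogonal_projection_exists[where T = ?S])
    show "finite ?S" "finite ?S" "?S \<subseteq> ?S" by simp_all
    show "(\<lambda>p. 0) \<in> case_prod ` qalg k G"
      using qalg.zero by (rule rev_image_eqI) (auto simp: mzero_def)
    fix A B c assume "A \<in> case_prod ` qalg k G" "B \<in> case_prod ` qalg k G"
    then obtain A' B' where "A' \<in> qalg k G" "A = case_prod A'" "B' \<in> qalg k G" "B = case_prod B'" by blast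
    then show "(\<lambda>p. A p + c * B p) \<in> case_prod ` qalg k G"
      by (intro rev_image_eqI[of "madd A' (msmult c B')"] qalg.intros) (auto simp: madd_def msmult_def)
    show "A p = 0" if "A \<in> case_prod ` qalg k G" "p \<notin> ?S" for A p
      using that by (cases p) (auto simp: tuples_def tspace_def dest!: qalg_tspace)
  qed
  then show ?thesis by (auto simp: tinner_cip cip_diff_right)
qed

text \<open>The difference lies in the algebra and is orthogonal to it, hence to itself. This makes
  the projection unique.\<close>

lemma qalg_eqI:
  fixes G :: "'a::finite \<Rightarrow> 'a \<Rightarrow> bool"
  assumes "Y \<in> qalg k G" "Y' \<in> qalg k G" "\<And>A. A \<in> qalg k G \<Longrightarrow> tinner k A Y = tinner k A Y'"
  shows "Y = Y'"
proof -
  let ?D = "madd Y (msmult (-1) Y')"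
  have D: "?D \<in> qalg k G" using assms by (intro qalg.intros)
  have "tinner k ?D ?D = 0"
    using assms(3)[OF D] by (simp only: tinner_madd_right tinner_msmult_right) simp
  then have "?D = mzero" using tinner_self_eq_0 qalg_tspace[OF D] by blast
  then show "Y = Y'" by (simp add: madd_def msmult_def mzero_def fun_eq_iff)
qed

text \<open>The column sums of \<open>psd_on_if_trace_tests\<close> become trace pairings of blocks,
  a form in which a map preserving products, adjoints and traces can transport them.\<close>

lemma sum_columns_qform:
  "(\<Sum>y\<in>tuples k. qform ({..<n} \<times> tuples k) (\<lambda>(i, x) (j, y). M i j x y) (\<lambda>(i, x). c i x y))
    = (\<Sum>i<n. \<Sum>j<n. tinner k (c i) (mmult k (M i j) (c j)))"
proof -
  let ?g = "\<lambda>y i x j z. cnj (c i x y) * M i j x z * c j z y"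
  have "(\<Sum>y\<in>tuples k. qform ({..<n} \<times> tuples k) (\<lambda>(i, x) (j, y). M i j x y) (\<lambda>(i, x). c i x y))
    = (\<Sum>y\<in>tuples k. \<Sum>i<n. \<Sum>x\<in>tuples k. \<Sum>j<n. \<Sum>z\<in>tuples k. ?g y i x j z)"
    by (simp add: qform_def sum.cartesian_product')
  also have "\<dots> = (\<Sum>i<n. \<Sum>y\<in>tuples k. \<Sum>x\<in>tuples k. \<Sum>j<n. \<Sum>z\<in>tuples k. ?g y i x j z)"
    by (rule sum.swap)
  also have "\<dots> = (\<Sum>i<n. \<Sum>y\<in>tuples k. \<Sum>j<n. \<Sum>x\<in>tuples k. \<Sum>z\<in>tuples k. ?g y i x j z)"
    by (intro sum.cong refl sum.swap)
  also have "\<dots> = (\<Sum>i<n. \<Sum>j<n. \<Sum>y\<in>tuples k. \<Sum>x\<in>tuples k. \<Sum>z\<in>tuples k. ?g y i x j z)"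
    by (intro sum.cong refl sum.swap)
  also have "\<dots> = (\<Sum>i<n. \<Sum>j<n. tinner k (c i) (mmult k (M i j) (c j)))"
    by (simp add: tinner_def mtrace_def mmult_def mctrans_def sum_distrib_left mult.assoc)
  finally show ?thesis .
qed

section \<open>From an algebraic equivalence to a quantum isomorphism map\<close>

lemma alg_equiv_imp_level_qi_map:
  fixes G :: "'a::finite \<Rightarrow> 'a \<Rightarrow> bool" and H :: "'b::finite \<Rightarrow> 'b \<Rightarrow> bool"
  assumes "alg_equiv k G H"
  shows "\<exists>\<Phi>. level_qi_map k G H \<Phi>"
proof -
  obtain \<phi> :: "'a tmat \<Rightarrow> 'b tmat" where bij: "bij_betw \<phi> (qalg k G) (qalg k H)"
    and lin: "\<forall>M\<in>qalg k G. \<forall>N\<in>qalg k G. \<forall>c.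
        \<phi> (madd M N) = madd (\<phi> M) (\<phi> N) \<and> \<phi> (msmult c M) = msmult c (\<phi> M)"
    and ctrans: "\<And>M. M\<in>qalg k G \<Longrightarrow> \<phi> (mctrans M) = mctrans (\<phi> M)"
    and mult: "\<And>M N. M\<in>qalg k G \<Longrightarrow> N\<in>qalg k G \<Longrightarrow> \<phi> (mmult k M N) = mmult k (\<phi> M) (\<phi> N)"
    and had: "\<And>F M. F\<in>QP k \<Longrightarrow> M\<in>qalg k G \<Longrightarrow> \<phi> (mhad (hom_tensor G F) M) = mhad (hom_tensor H F) (\<phi> M)"
    and I: "\<phi> (mI k) = mI k" and J: "\<phi> (mJ k) = mJ k"
    and hom: "\<And>F. F\<in>Qk k \<Longrightarrow> \<phi> (hom_tensor G F) = hom_tensor H F"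
    and perm: "\<And>\<sigma> M. \<sigma>\<in>cyc_group k \<Longrightarrow> M\<in>qalg k G \<Longrightarrow> \<phi> (pact k \<sigma> M) = pact k \<sigma> (\<phi> M)"
    and trace: "\<And>M. M\<in>qalg k G \<Longrightarrow> mtrace k (\<phi> M) = mtrace k M"
    using assms unfolding alg_equiv_def by (elim exE conjE) (rule that; blast)
  have add: "\<phi> (madd M N) = madd (\<phi> M) (\<phi> N)" if "M \<in> qalg k G" "N \<in> qalg k G" for M N
    using lin that by blast
  have smult: "\<phi> (msmult c M) = msmult c (\<phi> M)" if "M \<in> qalg k G" for M c
    using lin that by blast
  have \<phi>H: "\<phi> M \<in> qalg k H" if "M \<in> qalg k G" for M using bij that by (auto simp: bij_betw_def)
  have iso: "tinner k (\<phi> M) (\<phi> N) = tinner k M N" if "M \<in> qalg k G" "N \<in> qalg k G" for M N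
    using that by (simp add: tinner_def ctrans[symmetric] mult[symmetric] trace qalg.intros)
  define E where "E = (\<lambda>X. SOME Y. Y \<in> qalg k G \<and> (\<forall>A\<in>qalg k G. tinner k A Y = tinner k A X))"
  have E: "E X \<in> qalg k G \<and> (\<forall>A\<in>qalg k G. tinner k A (E X) = tinner k A X)" for X
    unfolding E_def by (rule someI_ex[where P = "\<lambda>Y. Y \<in> qalg k G \<and> (\<forall>A\<in>qalg k G. tinner k A Y = tinner k A X)"])
      (use qalg_projection_exists in blast)
  have EG: "E X \<in> qalg k G" for X using E by blast
  have ER: "tinner k A (E X) = tinner k A X" if "A \<in> qalg k G" for A X using E that by blast
  have EL: "tinner k (E X) A = tinner k X A" if "A \<in> qalg k G" for A X
    using ER[OF that, of X] by (metis tinner_cnj)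
  \<comment> \<open>This criterion yields the commutation facts: for Schur multiplication and
    rotations, the adjoint operation keeps the algebra invariant, so it can be moved onto the test
    matrix \<open>A\<close> before \<open>E\<close> is removed.\<close>
  have E_eqI: "E X = Y" if "Y \<in> qalg k G" "\<And>A. A \<in> qalg k G \<Longrightarrow> tinner k A X = tinner k A Y" for X Y
    by (rule qalg_eqI[OF EG that(1)]) (simp add: ER that(2))
  have E_id: "E A = A" if "A \<in> qalg k G" for A by (rule E_eqI[OF that]) simp
  have E_add: "E (madd X Y) = madd (E X) (E Y)" for X Y
    by (rule E_eqI) (simp_all add: EG ER tinner_madd_right qalg.add)
  have E_smult: "E (msmult c X) = msmult c (E X)" for c X
    by (rule E_eqI) (simp_all add: EG ER tinner_msmult_right qalg.smult)
  have E_ctrans: "E (mctrans X) = mctrans (E X)" for X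
  proof (rule E_eqI)
    fix A assume A: "A \<in> qalg k G"
    then show "tinner k A (mctrans X) = tinner k A (mctrans (E X))"
      using tinner_mctrans[of k "mctrans A" X] tinner_mctrans[of k "mctrans A" "E X"]
      by (simp add: EL qalg.ctrans)
  qed (simp add: EG qalg.ctrans)
  have E_had: "E (mhad (hom_tensor G F) X) = mhad (hom_tensor G F) (E X)" if "F \<in> QP k" for F X
    using that
    by (intro E_eqI) (simp_all add: EG ER qalg.had tinner_mhad[symmetric] cnj_hom_tensor)
  have E_perm: "E (pact k \<sigma> X) = pact k \<sigma> (E X)" if \<sigma>: "\<sigma> \<in> cyc_group k" for \<sigma> X
  proof (rule E_eqI)
    \<comment> \<open>\<open>pact k \<tau>\<close> serves as the adjoint of
      \<open>pact k \<sigma>\<close>.\<close>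
    obtain \<tau> where \<tau>: "\<tau> \<in> cyc_group k" "\<tau> \<circ> \<sigma> = id" using cyc_group_inverse[OF \<sigma>] by blast
    note p = cyc_group_permutes[OF \<sigma>] cyc_group_permutes[OF \<tau>(1)]
    have move: "tinner k A (pact k \<sigma> Y) = tinner k (pact k \<tau> A) Y" if "A \<in> qalg k G" for A Y
      using tinner_pact[OF p(1), of "pact k \<tau> A" Y] pact_inverse[OF p \<tau>(2) qalg_tspace[OF that]] by simp
    fix A assume "A \<in> qalg k G"
    then show "tinner k A (pact k \<sigma> X) = tinner k A (pact k \<sigma> (E X))"
      by (simp add: move ER qalg.perm \<tau>)
  qed (simp add: EG qalg.perm \<sigma>)
  define \<Phi> where "\<Phi> = (\<lambda>X. \<phi> (E X))"
  have cp: "completely_positive k \<Phi>"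
    unfolding completely_positive_def
  proof (intro allI impI)
    fix n and B :: "nat \<Rightarrow> nat \<Rightarrow> 'a tmat"
    assume BT: "\<forall>i j. B i j \<in> tspace k" and "block_psd k n B"
    then have Bpsd: "psd_on ({..<n} \<times> tuples k) (\<lambda>(i, x) (j, y). B i j x y)" by (simp add: block_psd_iff)
    let ?S = "{..<n} \<times> tuples k :: (nat \<times> 'b list) set"
    define Z where "Z = (\<lambda>(i, x) (j, y). \<Phi> (B i j) x y)"
    \<comment> \<open>Block matrices with blocks in the algebra of \<open>H\<close> again form an
      algebra, to which the trace criterion applies.\<close>
    define \<B> :: "(nat \<times> 'b list \<Rightarrow> nat \<times> 'b list \<Rightarrow> complex) set" where
       "\<B> = {(\<lambda>(i, x) (j, y). C i j x y) | C. \<forall>i j. C i j \<in> qalg k H}"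
    have BI: "(\<lambda>(i, x) (j, y). C i j x y) \<in> \<B>" if "\<And>i j. C i j \<in> qalg k H" for C
      using that unfolding \<B>_def by blast
    have "psd_on ?S Z"
    proof (rule psd_on_if_trace_tests[where B = \<B> and U = "\<lambda>(i, x) (j, y). (if i = j then mI k else mzero) x y"])
      show "finite ?S" by simp
    next
      fix p q assume p: "p \<in> ?S" and q: "q \<in> ?S"
      obtain i x j y where ij: "p = (i, x)" "q = (j, y)" by (metis surj_pair)
      have "B j i = mctrans (B i j)"
      proof (rule tspace_eqI)
        fix a b :: "'a list" assume "a \<in> tuples k" "b \<in> tuples k"
        then show "B j i a b = mctrans (B i j) a b"
          using psd_on_hermitian[OF _ Bpsd, of "(i, b)" "(j, a)"] p q ij by (simp add: mctrans_def)
      qed (use BT in \<open>auto intro: tspace_intros\<close>)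
      then have "\<Phi> (B j i) = mctrans (\<Phi> (B i j))"
        by (simp add: \<Phi>_def E_ctrans ctrans EG)
      then show "Z q p = cnj (Z p q)" by (simp add: Z_def ij mctrans_def)
    next
      show "(\<lambda>(i, x) (j, y). (if i = j then mI k else mzero) x y) \<in> \<B>"
        by (rule BI) (simp add: qalg.intros)
    next
      fix p q assume "p \<in> ?S" "q \<in> ?S"
      then show "(case p of (i, x) \<Rightarrow> \<lambda>(j, y). (if i = j then mI k else mzero) x y) q = (if p = q then 1 else 0)"
        by (auto simp: mI_def mzero_def tuples_def split: prod.splits)
    next
      show "Z \<in> \<B>" unfolding Z_def by (rule BI) (simp add: \<Phi>_def \<phi>H EG)
    next
      fix P Q c assume "P \<in> \<B>" "Q \<in> \<B>"
      then obtain C D where CD: "\<And>i j. C i j \<in> qalg k H" "P = (\<lambda>(i, x) (j, y). C i j x y)"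
        "\<And>i j. D i j \<in> qalg k H" "Q = (\<lambda>(i, x) (j, y). D i j x y)" unfolding \<B>_def by blast
      have "(\<lambda>p q. P p q + c * Q p q) = (\<lambda>(i, x) (j, y). madd (C i j) (msmult c (D i j)) x y)"
        by (auto simp: CD(2,4) madd_def msmult_def fun_eq_iff)
      then show "(\<lambda>p q. P p q + c * Q p q) \<in> \<B>" using CD(1,3) by (auto intro!: BI qalg.intros)
      have "(\<lambda>p q. \<Sum>r\<in>?S. P p r * Q r q)
          = (\<lambda>(i, x) (j, y). (\<lambda>x y. \<Sum>l\<in>{..<n}. mmult k (C i l) (D l j) x y) x y)"
        by (auto simp: CD(2,4) mmult_def fun_eq_iff sum.cartesian_product')
      then show "(\<lambda>p q. \<Sum>r\<in>?S. P p r * Q r q) \<in> \<B>"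
        using CD(1,3) by (auto intro!: BI qalg_sum qalg.intros)
    next
      fix P assume "P \<in> \<B>"
      then obtain C where C: "\<And>i j. C i j \<in> qalg k H" "P = (\<lambda>(i, x) (j, y). C i j x y)"
        unfolding \<B>_def by blast
      define D where "D = (\<lambda>i j. inv_into (qalg k G) \<phi> (C i j))"
      have D: "D i j \<in> qalg k G" "\<phi> (D i j) = C i j" for i j
        using C(1)[of i j] bij unfolding D_def bij_betw_def by (metis inv_into_into, metis f_inv_into_f)
      have t: "tinner k (C i l) (mmult k (\<Phi> (B i j)) (C j l)) = tinner k (D i l) (mmult k (B i j) (D j l))" for i j l
      proof -
        have "tinner k (C i l) (mmult k (\<Phi> (B i j)) (C j l)) = tinner k (D i l) (mmult k (E (B i j)) (D j l))"
          by (simp add: D(2)[symmetric] \<Phi>_def D EG mult[symmetric] iso qalg.mult del: D(2))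
        then show ?thesis by (simp add: tinner_mmult_right ER qalg.intros D)
      qed
      have P: "(\<lambda>p. P p (l, y)) = (\<lambda>(i, x). C i l x y)" for l y by (auto simp: C(2))
      have "(\<Sum>q\<in>?S. qform ?S Z (\<lambda>p. P p q))
          = (\<Sum>l<n. \<Sum>y\<in>tuples k. qform ?S (\<lambda>(i, x) (j, y). \<Phi> (B i j) x y) (\<lambda>(i, x). C i l x y))"
        by (simp add: sum.cartesian_product' Z_def P)
      \<comment> \<open>Regrouped into columns, the pairings are values of the form of
        \<open>B\<close> at the columns of \<open>D\<close>, so positivity of \<open>B\<close>
        finishes the test.\<close>
      also have "\<dots> = (\<Sum>l<n. \<Sum>y\<in>tuples k. qform ({..<n} \<times> tuples k) (\<lambda>(i, x) (j, y). B i j x y) (\<lambda>(i, x). D i l x y))"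
        by (simp add: sum_columns_qform t)
      finally show "0 \<le> Re (\<Sum>q\<in>?S. qform ?S Z (\<lambda>p. P p q))"
        using Bpsd by (simp add: psd_on_def sum_nonneg)
    qed
    then show "block_psd k n (\<lambda>i j. \<Phi> (B i j))" by (simp add: block_psd_iff Z_def)
  qed
  \<comment> \<open>\<open>\<phi>\<close> is isometric and \<open>E\<close> is self-adjoint and
    fixes \<open>A\<close>, so the adjoint of \<open>\<Phi>\<close> inverts \<open>\<phi>\<close> on
    the algebra; \<open>mI k\<close> and \<open>mJ k\<close> are the cases required.\<close>
  have adj: "adjoint k \<Phi> (\<phi> A) = A" if A: "A \<in> qalg k G" for A
  proof (rule tspace_eqI[OF _ qalg_tspace[OF A]])
    show "adjoint k \<Phi> (\<phi> A) \<in> tspace k" by (simp add: tspace_def adjoint_def)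
    fix x y :: "'a list" assume xy: "x \<in> tuples k" "y \<in> tuples k"
    then have "adjoint k \<Phi> (\<phi> A) x y = tinner k (munit x y) A"
      by (simp add: adjoint_def tuples_def \<Phi>_def iso EG A EL)
    then show "adjoint k \<Phi> (\<phi> A) x y = A x y" by (simp add: tinner_munit_left xy)
  qed
  have "level_qi_map k G H \<Phi>"
    unfolding level_qi_map_def
  proof (intro conjI ballI)
    show "\<Phi> ` tspace k \<subseteq> tspace k" using qalg_tspace[OF \<phi>H[OF EG]] by (auto simp: \<Phi>_def)
    show "lin_on k \<Phi>" by (simp add: lin_on_def \<Phi>_def E_add E_smult add smult EG)
    show "completely_positive k \<Phi>" by (rule cp)
    show "\<Phi> (mI k) = mI k" "\<Phi> (mJ k) = mJ k" by (simp_all add: \<Phi>_def E_id qalg.intros I J)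
    show "adjoint k \<Phi> (mI k) = mI k" using adj[OF qalg.I] by (simp add: I)
    show "adjoint k \<Phi> (mJ k) = mJ k" using adj[OF qalg.J] by (simp add: J)
  qed (simp_all add: \<Phi>_def E_had had E_perm perm E_id hom qalg.hom EG)
  then show ?thesis by blast
qed

theorem theorem3p10:
  fixes k :: nat
    and G :: "'a::finite \<Rightarrow> 'a \<Rightarrow> bool"
    and H :: "'b::finite \<Rightarrow> 'b \<Rightarrow> bool"
  assumes "k \<ge> 1"
    and "simple_graph G" and "simple_graph H"
    and "CARD('a) = CARD('b)"
  shows "alg_equiv k G H \<longleftrightarrow> (\<exists>\<Phi>. level_qi_map k G H \<Phi>)"
  using alg_equiv_imp_level_qi_map level_qi_map_imp_alg_equiv[OF assms(4)] by blast

end
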